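(* Consider a joint distribution $\mathcal{L}(\tau,T)$ of a random object $\tau$ and a real random variable $T$, and a $\tau$-measurable real random variable $V=V_\tau$. Suppose that when one samples $\tau$ and then, given $\tau$, samples $T$ and $T'$ independently from the conditional distribution $\mathcal{L}(T\mid\tau)$, the random variables $$W=V+T\quad\text{and}\quad W'=V+T'$$ have variance one and form an $a$-Stein pair. Write $$\mu_\tau=\mathbb{E}(T\mid\tau)\quad\text{and}\quad \sigma_\tau^2=\mathbb{E}\big((T-\mu_\tau)^2\mid\tau\big),$$ and let $dF(\tau)$ denote the distribution of $\tau$. Then the measure $F^\Box$ specified by $$dF^\Box(\tau)=\frac{\sigma_\tau^2}{a}\,dF(\tau)$$ is a probability measure, and for any coupling of $\tau$ to a random object $\tau^\Box$ with distribution $F^\Box$, $$\|\mathcal{L}(W)-\mathcal{L}(Z)\|_1\le 2\,\mathbb{E}\big|(V_{\tau^\Box}-V_\tau)+(\mu_{\tau^\Box}-\mu_\tau)\big|+2\,\mathbb{E}|T-\mu_\tau|+\frac{\mathbb{E}|T-\mu_\tau|^3}{\mathrm{Var}(T-\mu_\tau)},$$ where $Z$ is a standard normal random variable. Moreover, when $\mu_\tau=0$ and $\sigma_\tau^2$ is constant almost surely, $$\|\mathcal{L}(W)-\mathcal{L}(Z)\|_1\le 2\,\mathbb{E}|T|+\frac{\mathbb{E}|T|^3}{\mathrm{Var}(T)}.$$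
   Context: For $a\in(0,1]$, an $a$-Stein pair is a pair $(W,W')$ of exchangeable real random variables with $\mathbb{E}(W'\mid W)=(1-a)W$. $\mathcal{L}(X)$ denotes the distribution of $X$. $\|\mathcal{L}(X)-\mathcal{L}(Y)\|_1$ is the $L^1$ distance $\int_{-\infty}^\infty |P(X\le t)-P(Y\le t)|\,dt$ between distribution functions (equivalently, the Wasserstein-1 distance). The random object $\tau$ takes values in a measurable space on which regular conditional distributions of $T$ given $\tau$ are available. The quantities $V_\tau,\mu_\tau,\sigma_\tau^2$ are regarded as functions of the value of $\tau$; $V_{\tau^\Box}$ and $\mu_{\tau^\Box}$ are these functions evaluated at $\tau^\Box$. *)

theory Defs
  imports "HOL-Probability.Probability"
begin

definition exchangeable_pair :: "'a measure \<Rightarrow> ('a \<Rightarrow> real) \<Rightarrow> ('a \<Rightarrow> real) \<Rightarrow> bool" where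
  "exchangeable_pair M W W' \<longleftrightarrow>
     W \<in> borel_measurable M \<and> W' \<in> borel_measurable M \<and>
     distr M (borel \<Otimes>\<^sub>M borel) (\<lambda>x. (W x, W' x)) = distr M (borel \<Otimes>\<^sub>M borel) (\<lambda>x. (W' x, W x))"

text \<open>The sigma-algebra generated by a random element \<open>X\<close> with values in \<open>S\<close> is
  \<open>vimage_algebra (space M) X S\<close>.\<close>

definition stein_pair :: "'a measure \<Rightarrow> real \<Rightarrow> ('a \<Rightarrow> real) \<Rightarrow> ('a \<Rightarrow> real) \<Rightarrow> bool" where
  "stein_pair M a W W' \<longleftrightarrow>
     0 < a \<and> a \<le> 1 \<and> exchangeable_pair M W W' \<and> integrable M W \<and> integrable M W' \<and>
     (AE x in M. real_cond_exp M (vimage_algebra (space M) W borel) W' x = (1 - a) * W x)"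

text \<open>The kernel \<open>K\<close> is a regular conditional distribution, given the random element \<open>\<tau>\<close> of \<open>N\<close>,
  of the random element \<open>X\<close> of \<open>S\<close>.\<close>

definition regular_cond_distr ::
  "'a measure \<Rightarrow> 'b measure \<Rightarrow> ('a \<Rightarrow> 'b) \<Rightarrow> 'c measure \<Rightarrow> ('a \<Rightarrow> 'c) \<Rightarrow> ('b \<Rightarrow> 'c measure) \<Rightarrow> bool" where
  "regular_cond_distr M N \<tau> S X K \<longleftrightarrow>
     \<tau> \<in> measurable M N \<and> X \<in> measurable M S \<and> K \<in> measurable N (prob_algebra S) \<and>
     (\<forall>B\<in>sets S. AE x in M.
        real_cond_exp M (vimage_algebra (space M) \<tau> N) (\<lambda>y. indicator B (X y)) x = measure (K (\<tau> x)) B)"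

text \<open>Conditional mean and variance as functions of the value \<open>t\<close> of the conditioning element,
  computed from a regular conditional distribution \<open>K\<close>. This does not presuppose that the variable
  itself is integrable.\<close>

definition cond_mean :: "('b \<Rightarrow> real measure) \<Rightarrow> 'b \<Rightarrow> real" where
  "cond_mean K t = (LINT y|K t. y)"

definition cond_variance :: "('b \<Rightarrow> real measure) \<Rightarrow> 'b \<Rightarrow> real" where
  "cond_variance K t = (LINT y|K t. (y - cond_mean K t)\<^sup>2)"

definition square_biased :: "real \<Rightarrow> ('b \<Rightarrow> real measure) \<Rightarrow> 'b measure \<Rightarrow> 'b measure" where
  "square_biased a K F = density F (\<lambda>t. ennreal (cond_variance K t / a))"

definition is_coupling ::
  "'q measure \<Rightarrow> 'b measure \<Rightarrow> ('q \<Rightarrow> 'b) \<Rightarrow> 'b measure \<Rightarrow> ('q \<Rightarrow> 'b) \<Rightarrow> 'b measure \<Rightarrow> bool" where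
  "is_coupling Q N X F Y G \<longleftrightarrow>
     prob_space Q \<and> X \<in> measurable Q N \<and> Y \<in> measurable Q N \<and> distr Q N X = F \<and> distr Q N Y = G"

definition L1_dist :: "real measure \<Rightarrow> real measure \<Rightarrow> ennreal" where
  "L1_dist \<mu> \<nu> = (\<integral>\<^sup>+ t. ennreal \<bar>cdf \<mu> t - cdf \<nu> t\<bar> \<partial>lborel)"

end

theory Submission
  imports Defs "HOL-Real_Asymp.Real_Asymp"
begin

text \<open>
  Let \<open>h\<close> be 1-Lipschitz and \<open>f\<close> the bounded solution of \<open>f'(w) - w f(w) = h(w) - E h(Z)\<close>; then
  \<open>\<bar>f\<bar> \<le> 1\<close> and \<open>f'\<close> is 2-Lipschitz. Put \<open>X = T - \<mu>\<^sub>\<tau>\<close> and \<open>m\<^sub>\<tau> = V\<^sub>\<tau> + \<mu>\<^sub>\<tau>\<close>, so that \<open>W = m\<^sub>\<tau> + X\<close>.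
  The Stein pair condition and the conditional independence of \<open>T\<close> and \<open>T'\<close> give
  \<open>a E[W f(W)] = E[(W - W') f(W)] = E[X f(m\<^sub>\<tau> + X)]\<close>, and the choice \<open>f(w) = w\<close> yields \<open>E \<sigma>\<^sub>\<tau>\<^sup>2 = a\<close>.
  Conditionally on \<open>\<tau>\<close>, Taylor expansion at \<open>m\<^sub>\<tau>\<close> replaces \<open>E[X f(m\<^sub>\<tau> + X)]\<close> by \<open>E[\<sigma>\<^sub>\<tau>\<^sup>2 f'(m\<^sub>\<tau>)]\<close>,
  which is \<open>a\<close> times the expectation of \<open>f'(m)\<close> under the square-biased law, at the cost of \<open>E \<bar>X\<bar>\<^sup>3\<close>;
  replacing \<open>E f'(W)\<close> by \<open>E f'(m\<^sub>\<tau>)\<close> costs \<open>2 E \<bar>X\<bar>\<close>, and the coupling bounds the difference of the two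
  expectations of \<open>f'(m)\<close>. No zero-bias coupling of \<open>W\<close> is needed.
\<close>

section \<open>Bounds for the solution of Stein's equation\<close>

lemma DERIV_std_normal_density:
  "(std_normal_density has_real_derivative - x * std_normal_density x) (at x)"
  unfolding std_normal_density_def
  by (auto intro!: derivative_eq_intros simp: field_simps power2_eq_square)

lemma std_normal_density_tendsto_0:
  "(std_normal_density \<longlongrightarrow> 0) at_top" "(std_normal_density \<longlongrightarrow> 0) at_bot"
  unfolding std_normal_density_def by real_asymp+

lemma tendsto_top_mono_le:
  fixes g :: "real \<Rightarrow> real"
  assumes "(g \<longlongrightarrow> l) at_top" and "\<And>x y. w \<le> x \<Longrightarrow> x \<le> y \<Longrightarrow> g x \<le> g y"
  shows "g w \<le> l"
proof (rule tendsto_lowerbound[OF assms(1)])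
  show "\<forall>\<^sub>F i in at_top. g w \<le> g i"
    using eventually_ge_at_top[of w] by eventually_elim (use assms(2) in auto)
qed auto

lemma tendsto_bot_antimono_le:
  fixes g :: "real \<Rightarrow> real"
  assumes "(g \<longlongrightarrow> l) at_bot" and "\<And>x y. x \<le> y \<Longrightarrow> y \<le> w \<Longrightarrow> g y \<le> g x"
  shows "g w \<le> l"
proof (rule tendsto_lowerbound[OF assms(1)])
  show "\<forall>\<^sub>F i in at_bot. g w \<le> g i"
    using eventually_le_at_bot[of w] by eventually_elim (use assms(2) in auto)
qed auto

text \<open>A function that is nondecreasing to the right of \<open>w\<close> stays below its limit.
  With limit 0 this turns a sign of the derivative on a half-line into a sign of the function at the
  endpoint.\<close>

lemma nonneg_deriv_limit_at_top_le:
  fixes g g' :: "real \<Rightarrow> real"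
  assumes lim: "(g \<longlongrightarrow> l) at_top"
    and der: "\<And>x. w \<le> x \<Longrightarrow> (g has_real_derivative g' x) (at x)"
    and nn: "\<And>x. w \<le> x \<Longrightarrow> 0 \<le> g' x"
  shows "g w \<le> l"
proof (rule tendsto_top_mono_le[OF lim])
  fix x y :: real assume "w \<le> x" "x \<le> y"
  then show "g x \<le> g y"
    using der nn by (intro DERIV_nonneg_imp_nondecreasing[of x y g]) (meson order_trans)+
qed

lemma nonpos_deriv_limit_at_bot_le:
  fixes g g' :: "real \<Rightarrow> real"
  assumes lim: "(g \<longlongrightarrow> l) at_bot"
    and der: "\<And>x. x \<le> w \<Longrightarrow> (g has_real_derivative g' x) (at x)"
    and np: "\<And>x. x \<le> w \<Longrightarrow> g' x \<le> 0"
  shows "g w \<le> l"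
proof (rule tendsto_bot_antimono_le[OF lim])
  fix x y :: real assume "x \<le> y" "y \<le> w"
  then show "g y \<le> g x"
    using der np by (intro DERIV_nonpos_imp_nonincreasing[of x y g]) (meson order_trans)+
qed

text \<open>The upper Gaussian tail has derivative \<open>- std_normal_density x\<close>. The
  surplus 2 / (1 + x^2)^2 over -1 is positive, which is why x / (1 + x^2) times the density lies
  below that tail.\<close>

lemma DERIV_mills_lower_bound:
  "((\<lambda>x. x / (1 + x\<^sup>2) * std_normal_density x) has_real_derivative
     (2 / (1 + x\<^sup>2)\<^sup>2 - 1) * std_normal_density x) (at x)"
proof -
  have pos: "1 + x\<^sup>2 > 0" by (smt (verit) zero_le_power2)
  have "((\<lambda>x. x / (1 + x\<^sup>2)) has_real_derivative (1 - x\<^sup>2) / (1 + x\<^sup>2)\<^sup>2) (at x)"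
    using pos by (auto intro!: derivative_eq_intros simp: power2_eq_square)
  from DERIV_mult[OF this DERIV_std_normal_density]
  have "((\<lambda>x. x / (1 + x\<^sup>2) * std_normal_density x) has_real_derivative
      ((1 - x\<^sup>2) / (1 + x\<^sup>2)\<^sup>2 - x * (x / (1 + x\<^sup>2))) * std_normal_density x) (at x)"
    by (simp add: algebra_simps)
  moreover have "(1 - x\<^sup>2) / (1 + x\<^sup>2)\<^sup>2 - x * (x / (1 + x\<^sup>2)) = 2 / (1 + x\<^sup>2)\<^sup>2 - 1"
    using pos by (simp add: divide_simps) (simp add: power2_eq_square algebra_simps)
  ultimately show ?thesis by simp
qed

lemma mills_lower_bound_tendsto_0:
  "((\<lambda>x. x / (1 + x\<^sup>2) * std_normal_density x) \<longlongrightarrow> 0) at_top"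
  "((\<lambda>x. x / (1 + x\<^sup>2) * std_normal_density x) \<longlongrightarrow> 0) at_bot"
  unfolding std_normal_density_def by real_asymp+

text \<open>With \<open>f = G / \<phi>\<close> the solution of Stein's equation for \<open>H\<close>, the two conclusions say \<open>f \<le> 0\<close>
  and \<open>(w f(w))' \<le> 0\<close>. Where \<open>w (H w - c) > 0\<close>, monotonicity of \<open>H\<close> and the lower bound
  \<open>w / (1 + w\<^sup>2) \<phi>(w)\<close> for the Gaussian tail give the second one; elsewhere it follows from the first.\<close>

lemma stein_primitive_mono_bounds:
  fixes H G :: "real \<Rightarrow> real" and c :: real
  assumes H: "mono H"
    and G: "\<And>x. (G has_real_derivative (H x - c) * std_normal_density x) (at x)"
    and top: "(G \<longlongrightarrow> 0) at_top" and bot: "(G \<longlongrightarrow> 0) at_bot"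
  shows "G w \<le> 0" and "(1 + w\<^sup>2) * G w + w * (H w - c) * std_normal_density w \<le> 0"
proof -
  have pos: "1 + w\<^sup>2 > 0" by (smt (verit) zero_le_power2)
  \<comment> \<open>By monotonicity of \<open>H\<close> the integrand keeps its sign on one side of
    \<open>w\<close>: either \<open>G\<close> increases to its limit 0 at plus infinity, or it
    decreases from its limit 0 at minus infinity.\<close>
  show neg: "G w \<le> 0"
  proof (cases "c \<le> H w")
    case True
    show ?thesis
      by (rule nonneg_deriv_limit_at_top_le[OF top G])
         (use True H in \<open>smt (verit) monoD mult_nonneg_nonneg normal_density_nonneg\<close>)
  next
    case False
    show ?thesis
      by (rule nonpos_deriv_limit_at_bot_le[OF bot G])
         (use False H in \<open>smt (verit) monoD mult_nonneg_nonneg mult_minus_left normal_density_nonneg\<close>)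
  qed
  have bnd: "G w + (H w - c) * (w / (1 + w\<^sup>2) * std_normal_density w) \<le> 0"
    if sgn: "(0 < w \<and> c < H w) \<or> (w < 0 \<and> H w < c)"
  proof -
    let ?g = "\<lambda>x. G x + (H w - c) * (x / (1 + x\<^sup>2) * std_normal_density x)"
    let ?g' = "\<lambda>x. (H x - c) * std_normal_density x
      + (H w - c) * ((2 / (1 + x\<^sup>2)\<^sup>2 - 1) * std_normal_density x)"
    have d: "(?g has_real_derivative ?g' x) (at x)" for x
      by (intro DERIV_add DERIV_cmult G DERIV_mills_lower_bound)
    \<comment> \<open>The coefficient \<open>H w - c\<close> is frozen at \<open>w\<close>, so the
      -1 in the derivative of the tail bound turns \<open>H x - c\<close> into
      \<open>H x - H w\<close>. On the half-line in question both summands then have the sign of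
      \<open>H w - c\<close>.\<close>
    have eq: "?g' x = ((H x - H w) + (H w - c) * (2 / (1 + x\<^sup>2)\<^sup>2)) * std_normal_density x" for x
      by (simp add: algebra_simps)
    from sgn show ?thesis
    proof
      assume w: "0 < w \<and> c < H w"
      show ?thesis
      proof (rule nonneg_deriv_limit_at_top_le[of ?g 0 w ?g'])
        show "(?g \<longlongrightarrow> 0) at_top"
          using tendsto_add[OF top tendsto_mult_right_zero[OF mills_lower_bound_tendsto_0(1)]] by simp
        show "0 \<le> ?g' x" if "w \<le> x" for x
          unfolding eq using w monoD[OF H that] by (intro mult_nonneg_nonneg add_nonneg_nonneg) auto
      qed (rule d)
    next
      assume w: "w < 0 \<and> H w < c"
      show ?thesis
      proof (rule nonpos_deriv_limit_at_bot_le[of ?g 0 w ?g'])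
        show "(?g \<longlongrightarrow> 0) at_bot"
          using tendsto_add[OF bot tendsto_mult_right_zero[OF mills_lower_bound_tendsto_0(2)]] by simp
        show "?g' x \<le> 0" if "x \<le> w" for x
          unfolding eq using w monoD[OF H that]
          by (intro mult_nonpos_nonneg add_nonpos_nonpos) auto
      qed (rule d)
    qed
  qed
  show "(1 + w\<^sup>2) * G w + w * (H w - c) * std_normal_density w \<le> 0"
  proof (cases "(0 < w \<and> c < H w) \<or> (w < 0 \<and> H w < c)")
    case True
    have "(1 + w\<^sup>2) * G w + w * (H w - c) * std_normal_density w
        = (1 + w\<^sup>2) * (G w + (H w - c) * (w / (1 + w\<^sup>2) * std_normal_density w))"
      using pos by (simp add: field_simps)
    also have "\<dots> \<le> 0"
      using bnd[OF True] pos by (intro mult_nonneg_nonpos) auto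
    finally show ?thesis .
  next
    case False
    then have "w * (H w - c) \<le> 0" by (smt (verit) mult_nonneg_nonpos mult_nonpos_nonneg)
    then show ?thesis using neg pos
      by (intro add_nonpos_nonpos mult_nonneg_nonpos[of "1 + w\<^sup>2"]
          mult_nonpos_nonneg[of "w * (H w - c)"]) auto
  qed
qed

text \<open>The function x^2 - g(x) vanishes at 0, does not increase on the left of 0 and does not
  decrease on the right, so 0 is its minimum. The same argument applies to -g.\<close>

lemma DERIV_abs_le_double_imp_abs_le_square:
  fixes g g' :: "real \<Rightarrow> real"
  assumes "g 0 = 0" and d: "\<And>x. (g has_real_derivative g' x) (at x)"
    and b: "\<And>x. \<bar>g' x\<bar> \<le> 2 * \<bar>x\<bar>"
  shows "\<bar>g x\<bar> \<le> x\<^sup>2"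
proof -
  have key: "g x \<le> x\<^sup>2" if g0: "g 0 = 0" and d: "\<And>x. (g has_real_derivative g' x) (at x)"
    and b: "\<And>x. \<bar>g' x\<bar> \<le> 2 * \<bar>x\<bar>" for g g' :: "real \<Rightarrow> real"
  proof -
    have D: "((\<lambda>x. x\<^sup>2 - g x) has_real_derivative 2 * x - g' x) (at x)" for x
      by (auto intro!: derivative_eq_intros d)
    show ?thesis
    proof (cases "0 \<le> x")
      case True
      have "(\<lambda>x. x\<^sup>2 - g x) 0 \<le> (\<lambda>x. x\<^sup>2 - g x) x"
        by (rule DERIV_nonneg_imp_nondecreasing[OF True]) (use D b in \<open>smt (verit)\<close>)
      then show ?thesis using g0 by simp
    next
      case False
      then have "x \<le> 0" by simp
      have "(\<lambda>x. x\<^sup>2 - g x) 0 \<le> (\<lambda>x. x\<^sup>2 - g x) x"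
        by (rule DERIV_nonpos_imp_nonincreasing[OF \<open>x \<le> 0\<close>]) (use D b in \<open>smt (verit)\<close>)
      then show ?thesis using g0 by simp
    qed
  qed
  have "g x \<le> x\<^sup>2" by (rule key[OF assms])
  moreover have "- g x \<le> x\<^sup>2"
    using key[of "\<lambda>x. - g x" "\<lambda>x. - g' x"] assms by (auto intro: DERIV_minus)
  ultimately show ?thesis by simp
qed

lemma Lipschitz_borel_measurable:
  fixes h :: "real \<Rightarrow> real"
  assumes "\<And>x y. \<bar>h x - h y\<bar> \<le> C * \<bar>x - y\<bar>"
  shows "h \<in> borel_measurable borel" and "continuous_on UNIV h"
proof -
  have "C * \<bar>x - y\<bar> \<le> \<bar>C\<bar> * \<bar>x - y\<bar>" for x y by (intro mult_right_mono) auto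
  with assms have "\<bar>h x - h y\<bar> \<le> \<bar>C\<bar> * \<bar>x - y\<bar>" for x y by (meson order_trans)
  then have "\<bar>C\<bar>-lipschitz_on UNIV h"
    by (auto intro!: lipschitz_onI simp: dist_real_def)
  then show "continuous_on UNIV h" by (rule lipschitz_on_continuous_on)
  then show "h \<in> borel_measurable borel" by (rule borel_measurable_continuous_onI)
qed

lemma Lipschitz_integrable:
  fixes h :: "real \<Rightarrow> real"
  assumes "finite_measure M" and [measurable_cong]: "sets M = sets borel"
    and "\<And>x y. \<bar>h x - h y\<bar> \<le> \<bar>x - y\<bar>" and "integrable M (\<lambda>x. x)"
  shows "integrable M h"
proof -
  interpret finite_measure M by fact
  have [measurable]: "h \<in> borel_measurable borel"
    by (rule Lipschitz_borel_measurable(1)[where C = 1]) (use assms in auto)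
  show ?thesis
  proof (rule Bochner_Integration.integrable_bound)
    show "integrable M (\<lambda>x. \<bar>h 0\<bar> + \<bar>x\<bar>)" using assms by auto
    show "AE x in M. norm (h x) \<le> norm (\<bar>h 0\<bar> + \<bar>x\<bar>)"
    proof (rule AE_I2)
      fix x show "norm (h x) \<le> norm (\<bar>h 0\<bar> + \<bar>x\<bar>)"
        using assms(3)[of x 0] by auto
    qed
  qed auto
qed

lemma integrable_std_normal_distribution_id: "integrable std_normal_distribution (\<lambda>x. x)"
  using integrable_std_normal_distribution_moment[of 1] by simp

section \<open>Construction of the solution of Stein's equation\<close>

text \<open>\<open>G\<close> is the integral of the right-hand side times the density over all
  points up to \<open>w\<close>. Because \<open>c\<close> is the Gaussian mean of \<open>h\<close>,
  the integral over the whole line is 0, so \<open>G\<close> vanishes at both ends.\<close>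

lemma stein_primitive:
  fixes h :: "real \<Rightarrow> real"
  assumes h: "\<And>x y. \<bar>h x - h y\<bar> \<le> \<bar>x - y\<bar>"
  defines "c \<equiv> LINT z|std_normal_distribution. h z"
  obtains G where
    "\<And>x. (G has_real_derivative (h x - c) * std_normal_density x) (at x)"
    "(G \<longlongrightarrow> 0) at_top" "(G \<longlongrightarrow> 0) at_bot"
proof -
  let ?u = "\<lambda>x. (h x - c) * std_normal_density x"
  interpret Z: prob_space std_normal_distribution
    by (rule prob_space_normal_density) simp
  have [measurable]: "h \<in> borel_measurable borel" and cont: "continuous_on UNIV h"
    using Lipschitz_borel_measurable[of h 1] h by simp_all
  have "integrable std_normal_distribution h"
    by (rule Lipschitz_integrable[OF _ _ h integrable_std_normal_distribution_id])
       (simp_all add: Z.finite_measure_axioms)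
  then have "integrable std_normal_distribution (\<lambda>x. h x - c)" by auto
  then have iu: "integrable lborel ?u"
    by (subst (asm) integrable_density) (auto simp: mult.commute)
  have zero: "integral\<^sup>L lborel ?u = 0"
  proof -
    have "integral\<^sup>L lborel ?u = (LINT z|std_normal_distribution. h z - c)"
      by (subst integral_density) (auto simp: mult.commute)
    also have "\<dots> = 0"
      using \<open>integrable std_normal_distribution h\<close> by (simp add: c_def Z.prob_space[simplified])
    finally show ?thesis .
  qed
  define G where "G w = (LINT x|lborel. indicator {..w} x *\<^sub>R ?u x)" for w
  have top: "(G \<longlongrightarrow> 0) at_top"
    unfolding G_def using tendsto_integral_at_top[OF _ iu] zero by simp
  have si: "set_integrable lborel A ?u" if "A \<in> sets borel" for A
    unfolding set_integrable_def by (rule integrable_mult_indicator) (use that iu in auto)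
  \<comment> \<open>The oriented interval integral makes this hold for either order of
    \<open>v\<close> and \<open>w\<close>. It serves both the limit at minus infinity and the
    derivative.\<close>
  have split: "G w = G v + (LBINT x=v..w. ?u x)" for v w
  proof -
    have 1: "G w = G v + (LBINT x=v..w. ?u x)" if "v \<le> w" for v w
    proof -
      have "G w = (LINT x:{..v} \<union> {v<..w}|lborel. ?u x)"
        using that by (simp add: G_def set_lebesgue_integral_def ivl_disj_un)
      also have "\<dots> = (LINT x:{..v}|lborel. ?u x) + (LINT x:{v<..w}|lborel. ?u x)"
        by (rule set_integral_Un) (simp_all add: si disjoint_iff)
      finally show ?thesis
        using that by (simp add: G_def set_lebesgue_integral_def interval_integral_Ioc)
    qed
    show ?thesis
      using 1[of v w] 1[of w v] interval_integral_endpoints_reverse[of v w ?u]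
      by (cases "v \<le> w") auto
  qed
  have bot: "(G \<longlongrightarrow> 0) at_bot"
  proof -
    have "((\<lambda>a. set_lebesgue_integral lborel {a..0} ?u) \<longlongrightarrow> set_lebesgue_integral lborel {..0} ?u) at_bot"
      by (rule tendsto_set_lebesgue_integral_at_bot)
         (simp_all add: si)
    from tendsto_diff[OF tendsto_const[of "G 0"] this]
    have "((\<lambda>a. G 0 - set_lebesgue_integral lborel {a..0} ?u) \<longlongrightarrow> 0) at_bot"
      by (simp add: G_def set_lebesgue_integral_def)
    then show ?thesis
    proof (rule Lim_transform_eventually)
      show "\<forall>\<^sub>F a in at_bot. G 0 - set_lebesgue_integral lborel {a..0} ?u = G a"
        using eventually_le_at_bot[of 0]
      proof eventually_elim
        case (elim a)
        then show ?case using split[of 0 a] by (simp add: interval_integral_Icc)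
      qed
    qed
  qed
  have der: "(G has_real_derivative ?u x) (at x)" for x
  proof -
    \<comment> \<open>The base point is moved to \<open>x - 1\<close> so that \<open>x\<close> is
      interior to the interval of the fundamental theorem; \<open>split\<close> accounts for the
      change of base point.\<close>
    have "continuous_on {x - 1..x + 1} ?u"
      by (intro continuous_intros continuous_on_subset[OF cont] continuous_on_subset[OF
            DERIV_continuous_on[of UNIV std_normal_density]])
         (auto intro!: DERIV_std_normal_density)
    then have "((\<lambda>w. LBINT y=(x - 1)..w. ?u y) has_vector_derivative ?u x) (at x within {x - 1..x + 1})"
      by (intro interval_integral_FTC2) auto
    then have "((\<lambda>w. LBINT y=(x - 1)..w. ?u y) has_real_derivative ?u x) (at x)"
      by (subst (asm) at_within_interior) (auto simp: has_real_derivative_iff_has_vector_derivative)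
    then have "((\<lambda>w. G (x - 1) + (LBINT y=(x - 1)..w. ?u y)) has_real_derivative ?u x) (at x)"
      by (auto intro!: derivative_eq_intros)
    moreover have "(\<lambda>w. G (x - 1) + (LBINT y=(x - 1)..w. ?u y)) = G"
      by (rule ext) (rule split[symmetric])
    ultimately show ?thesis by simp
  qed
  show ?thesis by (rule that[OF der top bot])
qed

text \<open>Dividing the primitive by the density solves the equation. The function x f(x) has
  derivative bounded by 1 and \<open>h\<close> is 1-Lipschitz; their sum gives the constant 2 for f'
  although \<open>h\<close> need not be differentiable.\<close>

lemma stein_solution:
  fixes h :: "real \<Rightarrow> real"
  assumes h: "\<And>x y. \<bar>h x - h y\<bar> \<le> \<bar>x - y\<bar>"
  defines "c \<equiv> LINT z|std_normal_distribution. h z"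
  obtains f f' where
    "\<And>x. (f has_real_derivative f' x) (at x)"
    "\<And>x. f' x = x * f x + h x - c"
    "\<And>x. \<bar>f x\<bar> \<le> 1"
    "\<And>x y. \<bar>f' x - f' y\<bar> \<le> 2 * \<bar>x - y\<bar>"
proof -
  obtain G where G: "\<And>x. (G has_real_derivative (h x - c) * std_normal_density x) (at x)"
    and top: "(G \<longlongrightarrow> 0) at_top" and bot: "(G \<longlongrightarrow> 0) at_bot"
    using stein_primitive[OF h] unfolding c_def by blast
  have pos: "std_normal_density x > 0" for x by (rule normal_density_pos) simp
  define f where "f x = G x / std_normal_density x" for x
  have Gf: "G x = f x * std_normal_density x" for x
    using pos[of x] by (simp add: f_def)
  \<comment> \<open>\<open>x + s h x\<close> is monotone, and the Stein solution for the identity is constantly \<open>-1\<close>.\<close>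
  have signed: "-1 + s * f x \<le> 0 \<and> -1 + s * ((1 + x\<^sup>2) * f x + x * (h x - c)) \<le> 0"
    if s: "s = 1 \<or> s = -1" for s x :: real
  proof -
    let ?H = "\<lambda>x. x + s * h x" and ?G = "\<lambda>x. - std_normal_density x + s * G x"
    have m: "mono ?H"
    proof (rule monoI)
      fix x y :: real assume "x \<le> y"
      then show "?H x \<le> ?H y" using h[of x y] s by auto
    qed
    have d: "(?G has_real_derivative (?H x - s * c) * std_normal_density x) (at x)" for x
      by (auto intro!: derivative_eq_intros DERIV_std_normal_density G simp: algebra_simps)
    have t: "(?G \<longlongrightarrow> 0) at_top" "(?G \<longlongrightarrow> 0) at_bot"
      using tendsto_add[OF tendsto_minus[OF std_normal_density_tendsto_0(1)] tendsto_mult_right_zero[OF top, of s]]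
        tendsto_add[OF tendsto_minus[OF std_normal_density_tendsto_0(2)] tendsto_mult_right_zero[OF bot, of s]]
      by simp_all
    have "?G x = (-1 + s * f x) * std_normal_density x" by (simp add: Gf algebra_simps)
    moreover have "(1 + x\<^sup>2) * ?G x + x * (?H x - s * c) * std_normal_density x
        = (-1 + s * ((1 + x\<^sup>2) * f x + x * (h x - c))) * std_normal_density x"
      by (simp add: Gf algebra_simps power2_eq_square)
    ultimately show ?thesis
      using stein_primitive_mono_bounds[OF m d t, of x] pos[of x]
      by (metis mult_le_0_iff not_less)
  qed
  have f1: "\<bar>f x\<bar> \<le> 1" for x using signed[of 1 x] signed[of "-1" x] by auto
  have q1: "\<bar>(1 + x\<^sup>2) * f x + x * (h x - c)\<bar> \<le> 1" for x
    using signed[of 1 x] signed[of "-1" x] by auto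
  define f' where "f' x = x * f x + h x - c" for x
  have df: "(f has_real_derivative f' x) (at x)" for x
    unfolding f_def[abs_def]
    using pos[of x]
    by (auto intro!: derivative_eq_intros G DERIV_std_normal_density)
       (simp add: f'_def f_def field_simps)
  have dwf: "((\<lambda>x. x * f x) has_real_derivative (1 + x\<^sup>2) * f x + x * (h x - c)) (at x)" for x
    by (auto intro!: derivative_eq_intros df simp: f'_def algebra_simps power2_eq_square)
  have lip: "\<bar>x * f x - y * f y\<bar> \<le> \<bar>x - y\<bar>" for x y
    using field_differentiable_bound[of UNIV "\<lambda>x. x * f x"
        "\<lambda>x. (1 + x\<^sup>2) * f x + x * (h x - c)" 1 x y] dwf q1 by auto
  have "\<bar>f' x - f' y\<bar> \<le> 2 * \<bar>x - y\<bar>" for x y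
  proof -
    have "f' x - f' y = (x * f x - y * f y) + (h x - h y)" by (simp add: f'_def)
    then show ?thesis using lip[of x y] h[of x y] by (smt (verit))
  qed
  with df f1 show ?thesis by (intro that[of f f']) (auto simp: f'_def)
qed

text \<open>As a function of \<open>x\<close> the remainder has derivative f'(m + x) - f'(m), of
  size at most 2 |x|. A Lipschitz derivative thus replaces the second derivative of Taylor's
  formula.\<close>

lemma second_order_remainder_bound:
  fixes f f' :: "real \<Rightarrow> real"
  assumes d: "\<And>x. (f has_real_derivative f' x) (at x)"
    and lip: "\<And>x y. \<bar>f' x - f' y\<bar> \<le> 2 * \<bar>x - y\<bar>"
  shows "\<bar>f (m + x) - f m - f' m * x\<bar> \<le> x\<^sup>2"
proof (rule DERIV_abs_le_double_imp_abs_le_square[of "\<lambda>x. f (m + x) - f m - f' m * x" "\<lambda>x. f' (m + x) - f' m"])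
  fix x
  have "((\<lambda>x. f (m + x)) has_real_derivative f' (m + x)) (at x)"
    using DERIV_shift[of f "f' (m + x)" x m] d by (simp add: add.commute)
  then show "((\<lambda>x. f (m + x) - f m - f' m * x) has_real_derivative f' (m + x) - f' m) (at x)"
    by (auto intro!: derivative_eq_intros)
  show "\<bar>f' (m + x) - f' m\<bar> \<le> 2 * \<bar>x\<bar>" using lip[of "m + x" m] by simp
qed simp

section \<open>Duality between the distance of distribution functions and Lipschitz functions\<close>

text \<open>Chosen so that \<open>x\<close> is the integral of \<open>signed_layer x t\<close> over all real \<open>t\<close>.\<close>

definition signed_layer :: "real \<Rightarrow> real \<Rightarrow> real" where
  "signed_layer x t = (if 0 \<le> t then (if t < x then 1 else 0) else (if x \<le> t then -1 else 0))"

lemma measurable_signed_layer [measurable]: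
  assumes [measurable]: "f \<in> borel_measurable M" "g \<in> borel_measurable M"
  shows "(\<lambda>w. signed_layer (f w) (g w)) \<in> borel_measurable M"
  unfolding signed_layer_def by measurable

lemma abs_signed_layer:
  "\<bar>signed_layer x t\<bar> = indicator {0..<x} t + indicator {x..<0} t"
  by (auto simp: signed_layer_def indicator_def)

lemma signed_layer_diff:
  "y \<le> x \<Longrightarrow> signed_layer x t - signed_layer y t = indicator {y..<x} t"
  by (auto simp: signed_layer_def indicator_def)

lemma abs_signed_layer_integral:
  "integrable lborel (\<lambda>t. \<bar>signed_layer x t\<bar>)" "(LINT t|lborel. \<bar>signed_layer x t\<bar>) = \<bar>x\<bar>"
  unfolding abs_signed_layer by (cases "0 \<le> x"; auto)+

lemma signed_layer_integrable:
  assumes [measurable]: "s \<in> borel_measurable borel" and s: "\<And>t. \<bar>s t\<bar> \<le> (1::real)"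
  shows "integrable lborel (\<lambda>t. s t * signed_layer x t)"
proof (rule Bochner_Integration.integrable_bound[OF abs_signed_layer_integral(1)])
  show "AE t in lborel. norm (s t * signed_layer x t) \<le> norm \<bar>signed_layer x t\<bar>"
    by (rule AE_I2) (use s in \<open>auto simp: abs_mult intro: mult_left_le_one_le\<close>)
qed auto

text \<open>The function of \<open>x\<close> is the oriented integral of \<open>s\<close> from 0 to
  \<open>x\<close>. Two of its values differ by the integral of \<open>s\<close> over an interval of
  length |x - y|.\<close>

lemma signed_layer_integral_Lipschitz:
  assumes [measurable]: "s \<in> borel_measurable borel" and s: "\<And>t. \<bar>s t\<bar> \<le> (1::real)"
  shows "\<bar>(LINT t|lborel. s t * signed_layer x t) - (LINT t|lborel. s t * signed_layer y t)\<bar> \<le> \<bar>x - y\<bar>"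
proof -
  note int = signed_layer_integrable[OF assms]
  have *: "\<bar>(LINT t|lborel. s t * signed_layer x t) - (LINT t|lborel. s t * signed_layer y t)\<bar> \<le> \<bar>x - y\<bar>"
    if "y \<le> x" for x y
  proof -
    have "(LINT t|lborel. s t * signed_layer x t) - (LINT t|lborel. s t * signed_layer y t)
        = (LINT t|lborel. s t * indicator {y..<x} t)"
      by (simp add: int signed_layer_diff[OF that, symmetric] right_diff_distrib
          flip: Bochner_Integration.integral_diff)
    also have "\<bar>\<dots>\<bar> \<le> (LINT t|lborel. indicator {y..<x} t)"
    proof (rule integral_abs_bound_integral)
      have "integrable lborel (\<lambda>t. s t * signed_layer x t - s t * signed_layer y t)"
        by (intro Bochner_Integration.integrable_diff int)
      then show "integrable lborel (\<lambda>t. s t * indicator {y..<x} t)"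
        by (simp add: signed_layer_diff[OF that, symmetric] right_diff_distrib)
      show "integrable lborel (indicat_real {y..<x})"
        using that by (auto intro!: integrable_real_indicator)
      show "\<bar>s t * indicator {y..<x} t\<bar> \<le> indicator {y..<x} t" for t
        using s[of t] by (auto simp: indicator_def)
    qed
    also have "\<dots> = \<bar>x - y\<bar>" using that by simp
    finally show ?thesis .
  qed
  show ?thesis
  proof (cases "y \<le> x")
    case False
    then show ?thesis using *[of x y] by (simp add: abs_minus_commute)
  qed (rule *)
qed

text \<open>Integrating out \<open>x\<close> first turns the layer into a unit step at 0 minus the
  distribution function. The exchange is allowed because the layer has total absolute integral |x|,
  which is integrable. The step makes the result integrable on the whole line and cancels when two
  distributions are compared.\<close>

lemma signed_layer_Fubini:
  assumes "real_distribution \<mu>" and id: "integrable \<mu> (\<lambda>x. x)"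
    and [measurable]: "s \<in> borel_measurable borel" and s: "\<And>t. \<bar>s t\<bar> \<le> (1::real)"
  shows "(LINT x|\<mu>. LINT t|lborel. s t * signed_layer x t)
      = (LINT t|lborel. s t * ((if 0 \<le> t then 1 else 0) - cdf \<mu> t))"
    and "integrable lborel (\<lambda>t. s t * ((if 0 \<le> t then 1 else 0) - cdf \<mu> t))"
proof -
  interpret real_distribution \<mu> by fact
  interpret pair_sigma_finite \<mu> lborel ..
  let ?f = "\<lambda>(x, t). s t * signed_layer x t"
  have [measurable]: "?f \<in> borel_measurable (\<mu> \<Otimes>\<^sub>M lborel)"
    unfolding case_prod_beta by measurable
  have f: "integrable (\<mu> \<Otimes>\<^sub>M lborel) ?f"
  proof (rule Fubini_integrable)
    show "integrable \<mu> (\<lambda>x. LINT t|lborel. norm (case (x, t) of (x, t) \<Rightarrow> s t * signed_layer x t))"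
    proof (rule Bochner_Integration.integrable_bound[OF id])
      show "AE x in \<mu>. norm (LINT t|lborel. norm (case (x, t) of (x, t) \<Rightarrow> s t * signed_layer x t)) \<le> norm x"
      proof (rule AE_I2)
        fix x
        have "(LINT t|lborel. norm (s t * signed_layer x t)) \<le> (LINT t|lborel. \<bar>signed_layer x t\<bar>)"
          by (intro integral_mono abs_signed_layer_integral integrable_norm signed_layer_integrable)
             (use s in \<open>auto simp: abs_mult intro: mult_left_le_one_le\<close>)
        then show "norm (LINT t|lborel. norm (case (x, t) of (x, t) \<Rightarrow> s t * signed_layer x t)) \<le> norm x"
          by (simp add: abs_signed_layer_integral)
      qed
    qed measurable
    show "AE x in \<mu>. integrable lborel (\<lambda>t. case (x, t) of (x, t) \<Rightarrow> s t * signed_layer x t)"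
      using signed_layer_integrable[of s] s by simp
  qed measurable
  have layer: "(LINT x|\<mu>. s t * signed_layer x t) = s t * ((if 0 \<le> t then 1 else 0) - cdf \<mu> t)" for t
  proof -
    have "signed_layer x t = (if 0 \<le> t then 1 else 0) - indicator {..t} x" for x
      by (auto simp: signed_layer_def indicator_def)
    then have "(LINT x|\<mu>. signed_layer x t) = (if 0 \<le> t then 1 else 0) - cdf \<mu> t"
      using prob_space by (simp add: cdf_def emeasure_eq_measure)
    then show ?thesis by simp
  qed
  show "(LINT x|\<mu>. LINT t|lborel. s t * signed_layer x t)
      = (LINT t|lborel. s t * ((if 0 \<le> t then 1 else 0) - cdf \<mu> t))"
    using Fubini_integral[OF f] unfolding split_conv layer by (rule sym)
  show "integrable lborel (\<lambda>t. s t * ((if 0 \<le> t then 1 else 0) - cdf \<mu> t))"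
    using integrable_snd[OF f] unfolding split_conv layer .
qed

text \<open>One direction of Kantorovich-Rubinstein duality: a single 1-Lipschitz test function,
  with slope given by the sign of the difference of the distribution functions, already attains the
  distance.\<close>

lemma L1_dist_le_Lipschitz:
  assumes \<mu>: "real_distribution \<mu>" "integrable \<mu> (\<lambda>x. x)"
    and \<nu>: "real_distribution \<nu>" "integrable \<nu> (\<lambda>x. x)"
    and B: "\<And>h :: real \<Rightarrow> real. (\<And>x y. \<bar>h x - h y\<bar> \<le> \<bar>x - y\<bar>) \<Longrightarrow> integral\<^sup>L \<mu> h - integral\<^sup>L \<nu> h \<le> B"
  shows "L1_dist \<mu> \<nu> \<le> ennreal B"
proof -
  interpret \<mu>: real_distribution \<mu> by fact
  interpret \<nu>: real_distribution \<nu> by fact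
  have [measurable]: "cdf \<mu> \<in> borel_measurable borel" "cdf \<nu> \<in> borel_measurable borel"
    by (auto intro!: borel_measurable_mono monoI \<mu>.cdf_nondecreasing \<nu>.cdf_nondecreasing)
  let ?D = "\<lambda>t. cdf \<mu> t - cdf \<nu> t"
  \<comment> \<open>The minus sign compensates for the distribution function entering
    \<open>signed_layer_Fubini\<close> with a negative sign.\<close>
  define s where "s t = - sgn (?D t)" for t
  have s: "s \<in> borel_measurable borel" "\<And>t. \<bar>s t\<bar> \<le> 1"
    unfolding s_def[abs_def] by (auto simp: sgn_if)
  define h where "h x = (LINT t|lborel. s t * signed_layer x t)" for x
  note F\<mu> = signed_layer_Fubini[OF \<mu> s] and F\<nu> = signed_layer_Fubini[OF \<nu> s]
  have eq: "s t * ((if 0 \<le> t then 1 else 0) - cdf \<mu> t) - s t * ((if 0 \<le> t then 1 else 0) - cdf \<nu> t) = \<bar>?D t\<bar>" for t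
    by (auto simp: s_def sgn_if)
  have "integral\<^sup>L \<mu> h - integral\<^sup>L \<nu> h = (LINT t|lborel. \<bar>?D t\<bar>)"
    unfolding h_def F\<mu>(1) F\<nu>(1)
    by (subst Bochner_Integration.integral_diff[OF F\<mu>(2) F\<nu>(2), symmetric]) (simp only: eq)
  moreover have "integral\<^sup>L \<mu> h - integral\<^sup>L \<nu> h \<le> B"
    unfolding h_def by (rule B) (rule signed_layer_integral_Lipschitz[OF s])
  moreover have "integrable lborel (\<lambda>t. \<bar>?D t\<bar>)"
    using Bochner_Integration.integrable_diff[OF F\<mu>(2) F\<nu>(2)] by (simp only: eq)
  ultimately show ?thesis
    unfolding L1_dist_def by (subst nn_integral_eq_integral) (auto intro: ennreal_leI)
qed

section \<open>Disintegration along a regular conditional distribution\<close>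

locale regular_cond_distr_space = prob_space M
  for M :: "'a measure" +
  fixes N :: "'b measure" and \<tau> :: "'a \<Rightarrow> 'b" and S :: "'c measure" and X :: "'a \<Rightarrow> 'c"
    and K :: "'b \<Rightarrow> 'c measure"
  assumes rcd: "regular_cond_distr M N \<tau> S X K"
begin

lemma measurable_rcd [measurable]:
  "\<tau> \<in> measurable M N" "X \<in> measurable M S" "K \<in> measurable N (prob_algebra S)"
  using rcd by (auto simp: regular_cond_distr_def)

lemma measurable_kernel_subprob [measurable]: "K \<in> measurable N (subprob_algebra S)"
  by (rule measurable_prob_algebraD) measurable

lemma kernel:
  assumes "t \<in> space N"
  shows prob_space_kernel: "prob_space (K t)" and sets_kernel: "sets (K t) = sets S"
  using measurable_space[OF measurable_rcd(3) assms] by (auto simp: space_prob_algebra)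

lemma \<tau>_in_space: "x \<in> space M \<Longrightarrow> \<tau> x \<in> space N"
  using measurable_space[OF measurable_rcd(1)] .

lemma measurable_kernel_pair [measurable]:
  "(\<lambda>t. distr (K t) (N \<Otimes>\<^sub>M S) (Pair t)) \<in> measurable N (subprob_algebra (N \<Otimes>\<^sub>M S))"
  by (rule measurable_distr2[where M = S]) measurable

lemma measurable_Pair_kernel: "t \<in> space N \<Longrightarrow> Pair t \<in> measurable (K t) (N \<Otimes>\<^sub>M S)"
  using measurable_Pair1'[of t N S] by (simp add: sets_kernel cong: measurable_cong_sets)

text \<open>The defining property of \<open>K\<close> concerns one set \<open>B\<close> at a time,
  up to a null set depending on \<open>B\<close>. Multiplying by the indicator of a \<tau>-event and
  integrating gives agreement on rectangles, which form an intersection-stable generator of the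
  product sigma-algebra.\<close>

lemma joint_distr_eq_bind:
  "distr M (N \<Otimes>\<^sub>M S) (\<lambda>x. (\<tau> x, X x)) = distr M N \<tau> \<bind> (\<lambda>t. distr (K t) (N \<Otimes>\<^sub>M S) (Pair t))"
  (is "?L = ?R")
proof (rule measure_eqI_generator_eq[where E = "{A \<times> B | A B. A \<in> sets N \<and> B \<in> sets S}"
      and \<Omega> = "space N \<times> space S" and A = "\<lambda>_. space N \<times> space S"])
  \<comment> \<open>\<open>bind\<close> takes a default value over an empty space, which has to be
    excluded first.\<close>
  have ne: "space (distr M N \<tau>) \<noteq> {}" using \<tau>_in_space not_empty by auto
  have sets_R: "sets ?R = sets (N \<Otimes>\<^sub>M S)"
    using ne by (intro sets_bind[where N = "N \<Otimes>\<^sub>M S"]) auto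
  show "Int_stable {A \<times> B | A B. A \<in> sets N \<and> B \<in> sets S}"
    by (rule Int_stable_pair_measure_generator)
  show "{A \<times> B | A B. A \<in> sets N \<and> B \<in> sets S} \<subseteq> Pow (space N \<times> space S)"
    by (rule pair_measure_closed)
  show "sets ?L = sigma_sets (space N \<times> space S) {A \<times> B | A B. A \<in> sets N \<and> B \<in> sets S}"
    by (simp add: sets_pair_measure)
  show "sets ?R = sigma_sets (space N \<times> space S) {A \<times> B | A B. A \<in> sets N \<and> B \<in> sets S}"
    by (simp add: sets_R sets_pair_measure)
  show "range (\<lambda>_. space N \<times> space S) \<subseteq> {A \<times> B | A B. A \<in> sets N \<and> B \<in> sets S}" by auto
  show "(\<Union>i. space N \<times> space S) = space N \<times> space S" by simp
  show "emeasure ?L (space N \<times> space S) \<noteq> \<infinity>"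
  proof -
    have "prob_space ?L" by (rule prob_space_distr) measurable
    then show ?thesis by (simp add: prob_space.emeasure_le_1 prob_space.finite_measure finite_measure.emeasure_finite)
  qed
  fix Z assume "Z \<in> {A \<times> B | A B. A \<in> sets N \<and> B \<in> sets S}"
  then obtain A B where Z: "Z = A \<times> B" and [measurable]: "A \<in> sets N" "B \<in> sets S" by auto
  let ?V = "vimage_algebra (space M) \<tau> N"
  have sub: "subalgebra M ?V"
    by (auto simp: subalgebra_def sets_vimage_algebra2 \<tau>_in_space)
  interpret sub: finite_measure_subalgebra M ?V by unfold_locales (rule sub)
  have \<tau>V: "\<tau> \<in> measurable ?V N" by (rule measurable_vimage_algebra1) (simp add: \<tau>_in_space)
  have [measurable]: "(\<lambda>x. indicat_real A (\<tau> x)) \<in> borel_measurable ?V"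
    by (rule measurable_compose[OF \<tau>V]) measurable
  have int: "integrable M (\<lambda>x. indicat_real A (\<tau> x) * indicat_real B (X x))"
    by (rule integrable_const_bound[where B = 1]) (auto simp: indicator_def)
  have ce: "AE x in M. real_cond_exp M ?V (\<lambda>y. indicator B (X y)) x = measure (K (\<tau> x)) B"
    using rcd by (auto simp: regular_cond_distr_def)
  have [measurable]: "(\<lambda>t. measure (K t) B) \<in> borel_measurable N"
    by (rule measurable_compose[OF measurable_kernel_subprob]) measurable
  have "(LINT x|M. indicat_real A (\<tau> x) * indicat_real B (X x))
      = (LINT x|M. indicat_real A (\<tau> x) * real_cond_exp M ?V (\<lambda>y. indicator B (X y)) x)"
    by (rule sub.real_cond_exp_intg(2)[symmetric, OF int]) measurable
  also have "\<dots> = (LINT x|M. indicat_real A (\<tau> x) * measure (K (\<tau> x)) B)"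
    by (rule integral_cong_AE) (use ce in auto)
  finally have eq: "(LINT x|M. indicat_real A (\<tau> x) * indicat_real B (X x))
      = (LINT x|M. indicat_real A (\<tau> x) * measure (K (\<tau> x)) B)" .
  have "emeasure ?L Z = (\<integral>\<^sup>+ x. indicator Z (\<tau> x, X x) \<partial>M)"
  proof -
    have "emeasure ?L Z = (\<integral>\<^sup>+ z. indicator Z z \<partial>?L)"
      by (rule nn_integral_indicator[symmetric]) (simp add: Z)
    also have "\<dots> = (\<integral>\<^sup>+ x. indicator Z (\<tau> x, X x) \<partial>M)"
      by (rule nn_integral_distr) (auto simp: Z)
    finally show ?thesis .
  qed
  also have "\<dots> = (\<integral>\<^sup>+ x. ennreal (indicat_real A (\<tau> x) * indicat_real B (X x)) \<partial>M)"
    unfolding Z by (auto intro!: nn_integral_cong simp: indicator_def)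
  also have "\<dots> = ennreal (LINT x|M. indicat_real A (\<tau> x) * indicat_real B (X x))"
    by (rule nn_integral_eq_integral[OF int]) auto
  also have "\<dots> = (\<integral>\<^sup>+ x. ennreal (indicat_real A (\<tau> x) * measure (K (\<tau> x)) B) \<partial>M)"
    unfolding eq
  proof (rule nn_integral_eq_integral[symmetric])
    show "integrable M (\<lambda>x. indicat_real A (\<tau> x) * measure (K (\<tau> x)) B)"
      by (rule integrable_const_bound[where B = 1])
         (auto simp: indicator_def \<tau>_in_space prob_space_kernel intro!: prob_space.prob_le_1)
  qed auto
  also have "\<dots> = (\<integral>\<^sup>+ x. emeasure (distr (K (\<tau> x)) (N \<Otimes>\<^sub>M S) (Pair (\<tau> x))) Z \<partial>M)"
  proof (rule nn_integral_cong)
    fix x assume "x \<in> space M"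
    then have t: "\<tau> x \<in> space N" by (rule \<tau>_in_space)
    interpret k: prob_space "K (\<tau> x)" by (rule prob_space_kernel[OF t])
    have B: "B \<subseteq> space (K (\<tau> x))"
      using sets.sets_into_space[OF \<open>B \<in> sets S\<close>] sets_eq_imp_space_eq[OF sets_kernel[OF t]] by simp
    have "Pair (\<tau> x) -` Z \<inter> space (K (\<tau> x)) = (if \<tau> x \<in> A then B else {})"
      using B by (auto simp: Z)
    then show "ennreal (indicat_real A (\<tau> x) * measure (K (\<tau> x)) B)
        = emeasure (distr (K (\<tau> x)) (N \<Otimes>\<^sub>M S) (Pair (\<tau> x))) Z"
      by (subst emeasure_distr) (auto simp: Z measurable_Pair_kernel t k.emeasure_eq_measure)
  qed
  also have "\<dots> = (\<integral>\<^sup>+ t. emeasure (distr (K t) (N \<Otimes>\<^sub>M S) (Pair t)) Z \<partial>distr M N \<tau>)"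
    by (subst nn_integral_distr) (auto simp: Z intro!: measurable_compose[OF measurable_kernel_pair])
  also have "\<dots> = emeasure ?R Z"
    using ne by (subst emeasure_bind[where N = "N \<Otimes>\<^sub>M S"]) (auto simp: Z)
  finally show "emeasure ?L Z = emeasure ?R Z" .
qed

text \<open>Since no integrability is presupposed, this version can also establish integrability, by
  computing on the side of the kernel.\<close>

lemma nn_integral_disintegrate:
  assumes [measurable]: "g \<in> borel_measurable (N \<Otimes>\<^sub>M S)"
  shows "(\<integral>\<^sup>+ x. g (\<tau> x, X x) \<partial>M) = (\<integral>\<^sup>+ x. \<integral>\<^sup>+ y. g (\<tau> x, y) \<partial>K (\<tau> x) \<partial>M)"
proof -
  have "(\<integral>\<^sup>+ x. g (\<tau> x, X x) \<partial>M) = (\<integral>\<^sup>+ z. g z \<partial>distr M (N \<Otimes>\<^sub>M S) (\<lambda>x. (\<tau> x, X x)))"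
    by (subst nn_integral_distr) auto
  also have "\<dots> = (\<integral>\<^sup>+ t. \<integral>\<^sup>+ z. g z \<partial>distr (K t) (N \<Otimes>\<^sub>M S) (Pair t) \<partial>distr M N \<tau>)"
    unfolding joint_distr_eq_bind by (rule nn_integral_bind[where B = "N \<Otimes>\<^sub>M S"]) auto
  also have "\<dots> = (\<integral>\<^sup>+ x. \<integral>\<^sup>+ z. g z \<partial>distr (K (\<tau> x)) (N \<Otimes>\<^sub>M S) (Pair (\<tau> x)) \<partial>M)"
    by (rule nn_integral_distr)
       (auto intro!: measurable_compose[OF measurable_kernel_pair] nn_integral_measurable_subprob_algebra)
  also have "\<dots> = (\<integral>\<^sup>+ x. \<integral>\<^sup>+ y. g (\<tau> x, y) \<partial>K (\<tau> x) \<partial>M)"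
    by (intro nn_integral_cong nn_integral_distr measurable_Pair_kernel \<tau>_in_space) auto
  finally show ?thesis .
qed

text \<open>The integrand varies with \<open>t\<close>. Pushing \<open>K t\<close> forward along
  \<open>Pair t\<close> reduces this to integrating one fixed function against a measurable
  kernel.\<close>

lemma measurable_kernel_integral:
  fixes g :: "'b \<times> 'c \<Rightarrow> real"
  assumes [measurable]: "g \<in> borel_measurable (N \<Otimes>\<^sub>M S)"
  shows "(\<lambda>t. LINT y|K t. g (t, y)) \<in> borel_measurable N"
proof -
  have "(\<lambda>t. LINT z|distr (K t) (N \<Otimes>\<^sub>M S) (Pair t). g z) \<in> borel_measurable N"
    by (rule measurable_compose[OF measurable_kernel_pair integral_measurable_subprob_algebra]) measurable
  moreover have "(LINT z|distr (K t) (N \<Otimes>\<^sub>M S) (Pair t). g z) = (LINT y|K t. g (t, y))"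
    if "t \<in> space N" for t
    by (rule integral_distr[OF measurable_Pair_kernel[OF that] assms])
  ultimately show ?thesis by (simp cong: measurable_cong)
qed

lemma measurable_kernel_section:
  assumes "g \<in> measurable (N \<Otimes>\<^sub>M S) L" and "t \<in> space N"
  shows "(\<lambda>y. g (t, y)) \<in> measurable (K t) L"
  using measurable_compose[OF measurable_Pair_kernel[OF assms(2)] assms(1)] .

text \<open>A finite double integral of the absolute value makes the inner integral finite almost
  everywhere. The identity follows from the nonnegative case by splitting into positive and negative
  parts, so the auxiliary facts are proved for an arbitrary integrand.\<close>

lemma
  fixes g :: "'b \<times> 'c \<Rightarrow> real"
  assumes g [measurable]: "g \<in> borel_measurable (N \<Otimes>\<^sub>M S)" and int: "integrable M (\<lambda>x. g (\<tau> x, X x))"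
  shows AE_integrable_kernel: "AE x in M. integrable (K (\<tau> x)) (\<lambda>y. g (\<tau> x, y))"
    and integrable_kernel_integral: "integrable M (\<lambda>x. LINT y|K (\<tau> x). g (\<tau> x, y))"
    and integral_disintegrate: "(LINT x|M. g (\<tau> x, X x)) = (LINT x|M. LINT y|K (\<tau> x). g (\<tau> x, y))"
proof -
  have AE: "AE x in M. integrable (K (\<tau> x)) (\<lambda>y. g (\<tau> x, y))"
    if [measurable]: "g \<in> borel_measurable (N \<Otimes>\<^sub>M S)" and int: "integrable M (\<lambda>x. g (\<tau> x, X x))"
    for g :: "'b \<times> 'c \<Rightarrow> real"
  proof -
    have "(\<integral>\<^sup>+ x. \<integral>\<^sup>+ y. ennreal (norm (g (\<tau> x, y))) \<partial>K (\<tau> x) \<partial>M) < \<infinity>"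
      using int nn_integral_disintegrate[of "\<lambda>z. ennreal (norm (g z))"]
      by (simp add: integrable_iff_bounded)
    moreover have "(\<lambda>x. \<integral>\<^sup>+ y. ennreal (norm (g (\<tau> x, y))) \<partial>K (\<tau> x)) \<in> borel_measurable M"
      by (rule measurable_compose[OF measurable_rcd(1)], rule nn_integral_measurable_subprob_algebra2[where N = S])
         measurable
    ultimately have "AE x in M. (\<integral>\<^sup>+ y. ennreal (norm (g (\<tau> x, y))) \<partial>K (\<tau> x)) \<noteq> \<infinity>"
      by (intro nn_integral_PInf_AE) auto
    then show ?thesis
      using AE_space
    proof eventually_elim
      case (elim x)
      then show ?case
        by (auto simp: integrable_iff_bounded less_top \<tau>_in_space intro!: measurable_kernel_section)
    qed
  qed
  show AEg: "AE x in M. integrable (K (\<tau> x)) (\<lambda>y. g (\<tau> x, y))" by (rule AE[OF g int])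
  have meas [measurable]: "(\<lambda>x. LINT y|K (\<tau> x). g (\<tau> x, y)) \<in> borel_measurable M"
    if "g \<in> borel_measurable (N \<Otimes>\<^sub>M S)" for g :: "'b \<times> 'c \<Rightarrow> real"
    by (rule measurable_compose[OF measurable_rcd(1) measurable_kernel_integral[OF that]])
  have int': "integrable M (\<lambda>x. LINT y|K (\<tau> x). g (\<tau> x, y))"
    if [measurable]: "g \<in> borel_measurable (N \<Otimes>\<^sub>M S)" and int: "integrable M (\<lambda>x. g (\<tau> x, X x))"
    for g :: "'b \<times> 'c \<Rightarrow> real"
  proof (rule integrableI_bounded)
    have "(\<integral>\<^sup>+ x. ennreal (norm (LINT y|K (\<tau> x). g (\<tau> x, y))) \<partial>M)
        \<le> (\<integral>\<^sup>+ x. \<integral>\<^sup>+ y. ennreal (norm (g (\<tau> x, y))) \<partial>K (\<tau> x) \<partial>M)"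
      by (rule nn_integral_mono_AE) (use AE[OF that] in eventually_elim, rule integral_norm_bound_ennreal)
    also have "\<dots> < \<infinity>"
      using int nn_integral_disintegrate[of "\<lambda>z. ennreal (norm (g z))"]
      by (simp add: integrable_iff_bounded)
    finally show "(\<integral>\<^sup>+ x. ennreal (norm (LINT y|K (\<tau> x). g (\<tau> x, y))) \<partial>M) < \<infinity>" .
  qed (use that meas in auto)
  show "integrable M (\<lambda>x. LINT y|K (\<tau> x). g (\<tau> x, y))" by (rule int'[OF g int])
  have eq: "(LINT x|M. g (\<tau> x, X x)) = (LINT x|M. LINT y|K (\<tau> x). g (\<tau> x, y))"
    if [measurable]: "g \<in> borel_measurable (N \<Otimes>\<^sub>M S)" and int: "integrable M (\<lambda>x. g (\<tau> x, X x))"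
      and nn: "\<And>z. 0 \<le> g z"
    for g :: "'b \<times> 'c \<Rightarrow> real"
  proof -
    have "ennreal (LINT x|M. g (\<tau> x, X x)) = (\<integral>\<^sup>+ x. ennreal (g (\<tau> x, X x)) \<partial>M)"
      using nn by (intro nn_integral_eq_integral[symmetric] int) auto
    also have "\<dots> = (\<integral>\<^sup>+ x. \<integral>\<^sup>+ y. ennreal (g (\<tau> x, y)) \<partial>K (\<tau> x) \<partial>M)"
      by (rule nn_integral_disintegrate) measurable
    also have "\<dots> = (\<integral>\<^sup>+ x. ennreal (LINT y|K (\<tau> x). g (\<tau> x, y)) \<partial>M)"
    proof (rule nn_integral_cong_AE)
      show "AE x in M. (\<integral>\<^sup>+ y. ennreal (g (\<tau> x, y)) \<partial>K (\<tau> x)) = ennreal (LINT y|K (\<tau> x). g (\<tau> x, y))"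
        using AE[OF that(1,2)] by eventually_elim (intro nn_integral_eq_integral, auto simp: nn)
    qed
    also have "\<dots> = ennreal (LINT x|M. LINT y|K (\<tau> x). g (\<tau> x, y))"
      using nn by (intro nn_integral_eq_integral int' int) auto
    finally show ?thesis using nn by (subst (asm) ennreal_inj) auto
  qed
  let ?p = "\<lambda>z. max (g z) 0" and ?n = "\<lambda>z. max (- g z) 0"
  have p: "integrable M (\<lambda>x. ?p (\<tau> x, X x))" and n: "integrable M (\<lambda>x. ?n (\<tau> x, X x))"
    using int by auto
  have g_eq: "g z = ?p z - ?n z" for z by auto
  have "(LINT x|M. g (\<tau> x, X x)) = (LINT x|M. ?p (\<tau> x, X x) - ?n (\<tau> x, X x))"
    by (rule Bochner_Integration.integral_cong[OF refl]) auto
  also have "\<dots> = (LINT x|M. ?p (\<tau> x, X x)) - (LINT x|M. ?n (\<tau> x, X x))"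
    by (rule Bochner_Integration.integral_diff[OF p n])
  also have "\<dots> = (LINT x|M. LINT y|K (\<tau> x). ?p (\<tau> x, y)) - (LINT x|M. LINT y|K (\<tau> x). ?n (\<tau> x, y))"
    by (subst eq[OF _ p], simp, simp, subst eq[OF _ n]) auto
  also have "\<dots> = (LINT x|M. (LINT y|K (\<tau> x). ?p (\<tau> x, y)) - (LINT y|K (\<tau> x). ?n (\<tau> x, y)))"
    by (intro Bochner_Integration.integral_diff[symmetric] int' p n) auto
  also have "\<dots> = (LINT x|M. LINT y|K (\<tau> x). g (\<tau> x, y))"
  proof (rule integral_cong_AE)
    show "AE x in M. (LINT y|K (\<tau> x). ?p (\<tau> x, y)) - (LINT y|K (\<tau> x). ?n (\<tau> x, y)) = (LINT y|K (\<tau> x). g (\<tau> x, y))"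
      using AEg
    proof eventually_elim
      case (elim x)
      then have "(LINT y|K (\<tau> x). ?p (\<tau> x, y)) - (LINT y|K (\<tau> x). ?n (\<tau> x, y))
          = (LINT y|K (\<tau> x). ?p (\<tau> x, y) - ?n (\<tau> x, y))"
        by (intro Bochner_Integration.integral_diff[symmetric]) auto
      also have "\<dots> = (LINT y|K (\<tau> x). g (\<tau> x, y))"
        by (rule Bochner_Integration.integral_cong[OF refl]) auto
      finally show ?case .
    qed
  qed (intro borel_measurable_diff meas; measurable)+
  finally show "(LINT x|M. g (\<tau> x, X x)) = (LINT x|M. LINT y|K (\<tau> x). g (\<tau> x, y))" .
qed

end

section \<open>Stein pairs from conditionally independent copies\<close>

lemma integrable_mult_bounded:
  fixes f :: "real \<Rightarrow> real"
  assumes "integrable M u" and [measurable]: "v \<in> borel_measurable M" "f \<in> borel_measurable borel"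
    and "\<And>x. \<bar>f x\<bar> \<le> 1"
  shows "integrable M (\<lambda>x. u x * f (v x))"
proof (rule Bochner_Integration.integrable_bound[OF assms(1)])
  have [measurable]: "u \<in> borel_measurable M" using assms(1) by (rule borel_measurable_integrable)
  show "(\<lambda>x. u x * f (v x)) \<in> borel_measurable M" by measurable
  show "AE x in M. norm (u x * f (v x)) \<le> norm (u x)"
    by (rule AE_I2) (use assms(4) in \<open>auto simp: abs_mult intro: mult_left_le\<close>)
qed

text \<open>The product kernel in \<open>rcd2\<close> expresses that \<open>T\<close> and
  \<open>T'\<close> are independent given \<tau> with the common conditional law
  \<open>K\<close>.\<close>

locale conditional_stein_pair = prob_space M
  for M :: "'a measure" +
  fixes N :: "'b measure" and \<tau> :: "'a \<Rightarrow> 'b" and T T' :: "'a \<Rightarrow> real"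
    and V :: "'b \<Rightarrow> real" and K :: "'b \<Rightarrow> real measure" and a :: real
    and W W' :: "'a \<Rightarrow> real"
  defines W_def: "W \<equiv> \<lambda>x. V (\<tau> x) + T x"
    and W'_def: "W' \<equiv> \<lambda>x. V (\<tau> x) + T' x"
  assumes V [measurable]: "V \<in> borel_measurable N"
    and rcd1: "regular_cond_distr M N \<tau> borel T K"
    and rcd2: "regular_cond_distr M N \<tau> (borel \<Otimes>\<^sub>M borel) (\<lambda>x. (T x, T' x)) (\<lambda>t. K t \<Otimes>\<^sub>M K t)"
    and W_square: "integrable M (\<lambda>x. (W x)\<^sup>2)" and W_variance: "variance W = 1"
    and W'_square: "integrable M (\<lambda>x. (W' x)\<^sup>2)"
    and stein: "stein_pair M a W W'"
begin

sublocale T: regular_cond_distr_space M N \<tau> borel T K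
  by unfold_locales (rule rcd1)

sublocale TT': regular_cond_distr_space M N \<tau> "borel \<Otimes>\<^sub>M borel" "\<lambda>x. (T x, T' x)" "\<lambda>t. K t \<Otimes>\<^sub>M K t"
  by unfold_locales (rule rcd2)

abbreviation "\<mu> \<equiv> cond_mean K"
abbreviation "\<sigma>2 \<equiv> cond_variance K"
abbreviation "X \<equiv> \<lambda>x. T x - \<mu> (\<tau> x)"
abbreviation "m \<equiv> \<lambda>t. V t + \<mu> t"

section \<open>Moments of the pair and the Stein identity\<close>

lemma measurable_T' [measurable]: "T' \<in> borel_measurable M"
  using measurable_compose[OF TT'.measurable_rcd(2) measurable_snd] by simp

lemma measurable_W [measurable]: "W \<in> borel_measurable M" "W' \<in> borel_measurable M"
  unfolding W_def W'_def by measurable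

lemma measurable_cond_mean [measurable]: "\<mu> \<in> borel_measurable N"
  using T.measurable_kernel_integral[of snd] by (simp add: cond_mean_def[abs_def])

lemma measurable_cond_variance [measurable]: "\<sigma>2 \<in> borel_measurable N"
  using T.measurable_kernel_integral[of "\<lambda>(t, y). (y - \<mu> t)\<^sup>2"] by (simp add: cond_variance_def[abs_def])

lemma cond_variance_nonneg: "0 \<le> \<sigma>2 t"
  by (simp add: cond_variance_def)

lemma a_pos: "0 < a"
  using stein by (simp add: stein_pair_def)

lemma W_integrable: "integrable M W" "integrable M W'"
  using stein by (auto simp: stein_pair_def)

text \<open>The factor f(W) is measurable for the sigma-algebra of \<open>W\<close>, so
  \<open>W'\<close> may be replaced by its conditional expectation given \<open>W\<close>.\<close>

lemma expectation_W'_mult: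
  assumes [measurable]: "f \<in> borel_measurable borel" and int: "integrable M (\<lambda>x. W' x * f (W x))"
  shows "expectation (\<lambda>x. W' x * f (W x)) = (1 - a) * expectation (\<lambda>x. W x * f (W x))"
proof -
  let ?V = "vimage_algebra (space M) W borel"
  have sub: "subalgebra M ?V"
    by (auto simp: subalgebra_def sets_vimage_algebra2)
  interpret sub: finite_measure_subalgebra M ?V by unfold_locales (rule sub)
  have "W \<in> borel_measurable ?V" by (rule measurable_vimage_algebra1) simp
  then have fV: "(\<lambda>x. f (W x)) \<in> borel_measurable ?V" by measurable
  have ce: "AE x in M. real_cond_exp M ?V W' x = (1 - a) * W x"
    using stein by (simp add: stein_pair_def)
  have "expectation (\<lambda>x. W' x * f (W x)) = expectation (\<lambda>x. f (W x) * W' x)"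
    by (simp add: mult.commute)
  also have "\<dots> = expectation (\<lambda>x. f (W x) * real_cond_exp M ?V W' x)"
    by (rule sub.real_cond_exp_intg(2)[symmetric])
       (use int fV in \<open>auto simp: mult.commute\<close>)
  also have "\<dots> = expectation (\<lambda>x. (1 - a) * (W x * f (W x)))"
  proof (rule integral_cong_AE)
    show "AE x in M. f (W x) * real_cond_exp M ?V W' x = (1 - a) * (W x * f (W x))"
      using ce by eventually_elim simp
  qed auto
  finally show ?thesis by simp
qed

text \<open>Exchangeability gives equal means, while the regression property gives E W' = (1 - a) E
  W; hence a E W = 0. The variance is then the second moment.\<close>

lemma expectation_W: "expectation W = 0" and expectation_W_square: "expectation (\<lambda>x. (W x)\<^sup>2) = 1"
proof -
  have "distr M (borel \<Otimes>\<^sub>M borel) (\<lambda>x. (W x, W' x)) = distr M (borel \<Otimes>\<^sub>M borel) (\<lambda>x. (W' x, W x))"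
    using stein by (simp add: stein_pair_def exchangeable_pair_def)
  then have "integral\<^sup>L (distr M (borel \<Otimes>\<^sub>M borel) (\<lambda>x. (W x, W' x))) fst
      = integral\<^sup>L (distr M (borel \<Otimes>\<^sub>M borel) (\<lambda>x. (W' x, W x))) fst"
    by simp
  then have "expectation W = expectation W'"
    by (subst (asm) (1 2) integral_distr) auto
  moreover have "expectation W' = (1 - a) * expectation W"
    using expectation_W'_mult[of "\<lambda>_. 1"] W_integrable by simp
  ultimately show 0: "expectation W = 0"
    using a_pos by (simp add: algebra_simps)
  show "expectation (\<lambda>x. (W x)\<^sup>2) = 1"
    using W_variance 0 by simp
qed

text \<open>\<open>T\<close> itself is not assumed to be integrable. Given \<tau>, however,
  \<open>V\<close> is a constant, so the second moment of \<open>W\<close> passes to almost every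
  kernel measure.\<close>

lemma AE_kernel_moments:
  "AE x in M. integrable (K (\<tau> x)) (\<lambda>y. y) \<and> integrable (K (\<tau> x)) (\<lambda>y. y\<^sup>2)"
proof -
  have "AE x in M. integrable (K (\<tau> x)) (\<lambda>y. case (\<tau> x, y) of (t, y) \<Rightarrow> (V t + y)\<^sup>2)"
    by (rule T.AE_integrable_kernel) (use W_square in \<open>auto simp: W_def\<close>)
  then show ?thesis
    using AE_space
  proof eventually_elim
    case (elim x)
    interpret k: prob_space "K (\<tau> x)" by (rule T.prob_space_kernel) (use elim in \<open>simp add: T.\<tau>_in_space\<close>)
    have "sets (K (\<tau> x)) = sets borel"
      by (rule T.sets_kernel) (use elim in \<open>simp add: T.\<tau>_in_space\<close>)
    then have id: "(\<lambda>y. y) \<in> borel_measurable (K (\<tau> x))" by (rule measurable_ident_sets)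
    let ?v = "V (\<tau> x)"
    have 2: "integrable (K (\<tau> x)) (\<lambda>y. (?v + y)\<^sup>2)" using elim by simp
    have s: "integrable (K (\<tau> x)) (\<lambda>y. ?v + y)"
      by (rule k.square_integrable_imp_integrable[OF _ 2]) (intro borel_measurable_add borel_measurable_const id)
    have 1: "integrable (K (\<tau> x)) (\<lambda>y. y)"
      using Bochner_Integration.integrable_diff[OF s k.integrable_const[of ?v]] by simp
    have "integrable (K (\<tau> x)) (\<lambda>y. 2 * ?v * y + ?v\<^sup>2)"
      by (rule Bochner_Integration.integrable_add[OF integrable_mult_right[OF 1] k.integrable_const])
    from Bochner_Integration.integrable_diff[OF 2 this]
    have "integrable (K (\<tau> x)) (\<lambda>y. (?v + y)\<^sup>2 - (2 * ?v * y + ?v\<^sup>2))" .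
    then show ?case using 1 by (simp add: power2_sum)
  qed
qed

text \<open>W - W' = T - T', and integrating out the second copy under the product kernel replaces
  T' by the conditional mean. The regression property evaluates the same expectation as a E[W f(W)].
  Integrability of the products is assumed rather than boundedness of \<open>f\<close>, so that the
  identity function is covered.\<close>

lemma stein_identity:
  assumes f [measurable]: "f \<in> borel_measurable borel"
    and int: "integrable M (\<lambda>x. W x * f (W x))" and int': "integrable M (\<lambda>x. W' x * f (W x))"
  defines "c \<equiv> \<lambda>x. LINT y|K (\<tau> x). (y - \<mu> (\<tau> x)) * f (V (\<tau> x) + y)"
  shows "integrable M c" and "expectation c = a * expectation (\<lambda>x. W x * f (W x))"
proof -
  let ?g = "\<lambda>(t, y, y'). (y - y') * f (V t + y)"
  have g_eq: "?g (\<tau> x, T x, T' x) = W x * f (W x) - W' x * f (W x)" for x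
    by (simp add: W_def W'_def algebra_simps)
  have gm: "?g \<in> borel_measurable (N \<Otimes>\<^sub>M (borel \<Otimes>\<^sub>M borel))" by measurable
  have gi: "integrable M (\<lambda>x. ?g (\<tau> x, T x, T' x))"
    unfolding g_eq by (intro Bochner_Integration.integrable_diff int int')
  have cm: "c \<in> borel_measurable M"
  proof -
    have "(\<lambda>t. LINT y|K t. (\<lambda>(t, y). (y - \<mu> t) * f (V t + y)) (t, y)) \<in> borel_measurable N"
      by (rule T.measurable_kernel_integral) measurable
    from measurable_compose[OF T.measurable_rcd(1) this] show ?thesis by (simp add: c_def)
  qed
  have AEc: "AE x in M. (LINT z|(K (\<tau> x) \<Otimes>\<^sub>M K (\<tau> x)). ?g (\<tau> x, z)) = c x"
    using TT'.AE_integrable_kernel[OF gm gi] AE_kernel_moments AE_space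
  proof eventually_elim
    case (elim x)
    interpret k: prob_space "K (\<tau> x)" by (rule T.prob_space_kernel) (use elim in \<open>simp add: T.\<tau>_in_space\<close>)
    interpret kk: pair_sigma_finite "K (\<tau> x)" "K (\<tau> x)" ..
    have "(LINT y'|K (\<tau> x). y - y') = y - \<mu> (\<tau> x)" for y
      using elim by (simp add: cond_mean_def k.prob_space)
    then have "(LINT y'|K (\<tau> x). ?g (\<tau> x, y, y')) = (y - \<mu> (\<tau> x)) * f (V (\<tau> x) + y)" for y
      by simp
    then show ?case
      unfolding kk.integral_fst'[OF elim(1), symmetric] c_def
      by (rule Bochner_Integration.integral_cong[OF refl])
  qed
  show "integrable M c"
    by (rule integrable_cong_AE_imp[OF TT'.integrable_kernel_integral[OF gm gi] cm])
       (use AEc in eventually_elim, simp)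
  have "expectation c = (LINT x|M. LINT z|(K (\<tau> x) \<Otimes>\<^sub>M K (\<tau> x)). ?g (\<tau> x, z))"
    by (rule integral_cong_AE)
       (use AEc cm TT'.integrable_kernel_integral[OF gm gi] in auto)
  also have "\<dots> = (LINT x|M. ?g (\<tau> x, T x, T' x))"
    by (rule TT'.integral_disintegrate[OF gm gi, symmetric])
  also have "\<dots> = expectation (\<lambda>x. W x * f (W x)) - expectation (\<lambda>x. W' x * f (W x))"
    unfolding g_eq by (rule Bochner_Integration.integral_diff[OF int int'])
  finally show "expectation c = a * expectation (\<lambda>x. W x * f (W x))"
    by (simp add: expectation_W'_mult[OF f int'] algebra_simps)
qed

text \<open>For f(w) = w the integrand is (y - \<mu>)^2 + m (y - \<mu>), and the second term
  integrates to 0 under the kernel. The other side of the identity is a E W^2 = a.\<close>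

lemma cond_variance_integrable: "integrable M (\<lambda>x. \<sigma>2 (\<tau> x))"
  and expectation_cond_variance: "expectation (\<lambda>x. \<sigma>2 (\<tau> x)) = a"
proof -
  have W2: "integrable M (\<lambda>x. W x * W x)" using W_square by (simp add: power2_eq_square)
  have WW': "integrable M (\<lambda>x. W' x * W x)"
  proof (rule Bochner_Integration.integrable_bound)
    show "integrable M (\<lambda>x. (W x)\<^sup>2 + (W' x)\<^sup>2)"
      using W_square W'_square by auto
    show "AE x in M. norm (W' x * W x) \<le> norm ((W x)\<^sup>2 + (W' x)\<^sup>2)"
    proof (rule AE_I2)
      fix x
      have "2 * \<bar>W' x * W x\<bar> \<le> (W x)\<^sup>2 + (W' x)\<^sup>2"
        using sum_squares_bound[of "\<bar>W x\<bar>" "\<bar>W' x\<bar>"] by (simp add: abs_mult mult_ac)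
      then show "norm (W' x * W x) \<le> norm ((W x)\<^sup>2 + (W' x)\<^sup>2)" by simp
    qed
  qed auto
  note id = stein_identity[of "\<lambda>w. w", OF _ W2 WW']
  have AE: "AE x in M. (LINT y|K (\<tau> x). (y - \<mu> (\<tau> x)) * (V (\<tau> x) + y)) = \<sigma>2 (\<tau> x)"
    using AE_kernel_moments AE_space
  proof eventually_elim
    case (elim x)
    interpret k: prob_space "K (\<tau> x)" by (rule T.prob_space_kernel) (use elim in \<open>simp add: T.\<tau>_in_space\<close>)
    let ?\<mu> = "\<mu> (\<tau> x)"
    have i1: "integrable (K (\<tau> x)) (\<lambda>y. y - ?\<mu>)" using elim by auto
    have i2: "integrable (K (\<tau> x)) (\<lambda>y. (y - ?\<mu>)\<^sup>2)"
      using elim by (simp add: power2_diff)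
    have "(LINT y|K (\<tau> x). (y - ?\<mu>) * (V (\<tau> x) + y))
        = (LINT y|K (\<tau> x). (y - ?\<mu>)\<^sup>2 + m (\<tau> x) * (y - ?\<mu>))"
      by (rule Bochner_Integration.integral_cong) (auto simp: power2_eq_square algebra_simps)
    also have "\<dots> = \<sigma>2 (\<tau> x) + m (\<tau> x) * (LINT y|K (\<tau> x). y - ?\<mu>)"
      using i1 i2 by (simp add: cond_variance_def)
    also have "(LINT y|K (\<tau> x). y - ?\<mu>) = 0"
      using elim by (simp add: cond_mean_def k.prob_space)
    finally show ?case by simp
  qed
  show "integrable M (\<lambda>x. \<sigma>2 (\<tau> x))"
    by (rule integrable_cong_AE_imp[OF id(1)]) (use AE in \<open>auto elim: eventually_mono\<close>)
  have "expectation (\<lambda>x. \<sigma>2 (\<tau> x)) = (LINT x|M. LINT y|K (\<tau> x). (y - \<mu> (\<tau> x)) * (V (\<tau> x) + y))"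
    by (rule integral_cong_AE) (use AE id(1) in \<open>auto elim: eventually_mono\<close>)
  also have "\<dots> = a"
    using id(2) expectation_W_square by (simp add: power2_eq_square)
  finally show "expectation (\<lambda>x. \<sigma>2 (\<tau> x)) = a" .
qed

text \<open>The nonnegative disintegration reduces the second moment of \<open>X\<close> to the
  expected conditional variance, which is finite.\<close>

lemma X_square_integrable: "integrable M (\<lambda>x. (X x)\<^sup>2)"
  and expectation_X_square: "expectation (\<lambda>x. (X x)\<^sup>2) = a"
proof -
  have "(\<integral>\<^sup>+ x. ennreal ((X x)\<^sup>2) \<partial>M) = (\<integral>\<^sup>+ x. \<integral>\<^sup>+ y. ennreal ((y - \<mu> (\<tau> x))\<^sup>2) \<partial>K (\<tau> x) \<partial>M)"
    using T.nn_integral_disintegrate[of "\<lambda>(t, y). ennreal ((y - \<mu> t)\<^sup>2)"] by simp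
  also have "\<dots> = (\<integral>\<^sup>+ x. ennreal (\<sigma>2 (\<tau> x)) \<partial>M)"
  proof (rule nn_integral_cong_AE)
    show "AE x in M. (\<integral>\<^sup>+ y. ennreal ((y - \<mu> (\<tau> x))\<^sup>2) \<partial>K (\<tau> x)) = ennreal (\<sigma>2 (\<tau> x))"
      using AE_kernel_moments AE_space
    proof eventually_elim
      case (elim x)
      interpret k: prob_space "K (\<tau> x)" by (rule T.prob_space_kernel) (use elim in \<open>simp add: T.\<tau>_in_space\<close>)
      show ?case
        unfolding cond_variance_def
        by (rule nn_integral_eq_integral) (use elim in \<open>simp add: power2_diff\<close>, simp)
    qed
  qed
  also have "\<dots> = ennreal a"
    by (subst nn_integral_eq_integral[OF cond_variance_integrable])
       (simp_all add: cond_variance_nonneg expectation_cond_variance)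
  finally have eq: "(\<integral>\<^sup>+ x. ennreal ((X x)\<^sup>2) \<partial>M) = ennreal a" .
  show 2: "integrable M (\<lambda>x. (X x)\<^sup>2)"
    by (rule integrableI_nonneg) (auto simp: eq)
  show "expectation (\<lambda>x. (X x)\<^sup>2) = a"
    using eq a_pos by (subst integral_eq_nn_integral) auto
qed

lemma X_integrable: "integrable M X"
  by (rule square_integrable_imp_integrable[OF _ X_square_integrable]) measurable

lemma expectation_X: "expectation X = 0"
proof -
  have "expectation X = (LINT x|M. LINT y|K (\<tau> x). y - \<mu> (\<tau> x))"
    using T.integral_disintegrate[of "\<lambda>(t, y). y - \<mu> t"] X_integrable by simp
  also have "\<dots> = (LINT x|M. 0)"
  proof (rule integral_cong_AE)
    show "AE x in M. (LINT y|K (\<tau> x). y - \<mu> (\<tau> x)) = 0"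
      using AE_kernel_moments AE_space
    proof eventually_elim
      case (elim x)
      interpret k: prob_space "K (\<tau> x)" by (rule T.prob_space_kernel) (use elim in \<open>simp add: T.\<tau>_in_space\<close>)
      show ?case using elim by (simp add: cond_mean_def k.prob_space)
    qed
    show "(\<lambda>x. LINT y|K (\<tau> x). y - \<mu> (\<tau> x)) \<in> borel_measurable M"
      using T.integrable_kernel_integral[of "\<lambda>(t, y). y - \<mu> t"] X_integrable by auto
  qed simp
  finally show ?thesis by simp
qed

lemma variance_X: "variance X = a"
  by (simp add: expectation_X expectation_X_square)

section \<open>The square-biased law\<close>

text \<open>The total mass is the expected conditional variance divided by \<open>a\<close>.\<close>

lemma prob_space_square_biased: "prob_space (square_biased a K (distr M N \<tau>))"
proof (rule prob_spaceI)
  have "emeasure (square_biased a K (distr M N \<tau>)) (space N)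
      = (\<integral>\<^sup>+ t. ennreal (\<sigma>2 t / a) * indicator (space N) t \<partial>distr M N \<tau>)"
    unfolding square_biased_def by (rule emeasure_density) simp_all
  also have "\<dots> = (\<integral>\<^sup>+ x. ennreal (\<sigma>2 (\<tau> x) / a) * indicator (space N) (\<tau> x) \<partial>M)"
    by (rule nn_integral_distr) simp_all
  also have "\<dots> = (\<integral>\<^sup>+ x. ennreal (\<sigma>2 (\<tau> x) / a) \<partial>M)"
    by (rule nn_integral_cong) (simp add: T.\<tau>_in_space)
  also have "\<dots> = ennreal (expectation (\<lambda>x. \<sigma>2 (\<tau> x) / a))"
    by (rule nn_integral_eq_integral)
       (use cond_variance_integrable a_pos cond_variance_nonneg in simp_all)
  also have "\<dots> = 1"
    using a_pos by (simp add: expectation_cond_variance)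
  finally show "emeasure (square_biased a K (distr M N \<tau>)) (space (square_biased a K (distr M N \<tau>))) = 1"
    by (simp add: square_biased_def)
qed

lemma
  assumes [measurable]: "g \<in> borel_measurable N"
  shows integral_square_biased:
      "integral\<^sup>L (square_biased a K (distr M N \<tau>)) g = expectation (\<lambda>x. \<sigma>2 (\<tau> x) / a * g (\<tau> x))"
    and integrable_square_biased:
      "integrable (square_biased a K (distr M N \<tau>)) g \<longleftrightarrow> integrable M (\<lambda>x. \<sigma>2 (\<tau> x) / a * g (\<tau> x))"
proof -
  have nn: "0 \<le> \<sigma>2 t / a" for t using a_pos cond_variance_nonneg[of t] by simp
  show "integral\<^sup>L (square_biased a K (distr M N \<tau>)) g = expectation (\<lambda>x. \<sigma>2 (\<tau> x) / a * g (\<tau> x))"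
    unfolding square_biased_def by (subst integral_density) (auto simp: nn integral_distr)
  show "integrable (square_biased a K (distr M N \<tau>)) g \<longleftrightarrow> integrable M (\<lambda>x. \<sigma>2 (\<tau> x) / a * g (\<tau> x))"
    unfolding square_biased_def by (subst integrable_density) (auto simp: nn integrable_distr_eq)
qed

section \<open>The normal approximation bound\<close>

text \<open>By Stein's equation the left side is E f'(W) - E[W f(W)]. It is telescoped through the
  expectations of f'(m) under the law of \<tau> and under its square-biased law;
  \<open>step1\<close>, \<open>step2\<close> and \<open>step3\<close> give the three terms. A
  one-sided estimate is all that the duality lemma asks for.\<close>

lemma Lipschitz_expectation_bound:
  fixes h :: "real \<Rightarrow> real"
  assumes h: "\<And>x y. \<bar>h x - h y\<bar> \<le> \<bar>x - y\<bar>"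
    and X3: "integrable M (\<lambda>x. \<bar>X x\<bar> ^ 3)"
    and coupling: "is_coupling Q N X1 (distr M N \<tau>) X2 (square_biased a K (distr M N \<tau>))"
    and Q: "integrable Q (\<lambda>q. \<bar>m (X2 q) - m (X1 q)\<bar>)"
  shows "expectation (\<lambda>x. h (W x)) - (LINT z|std_normal_distribution. h z)
    \<le> 2 * (LINT q|Q. \<bar>m (X2 q) - m (X1 q)\<bar>) + 2 * expectation (\<lambda>x. \<bar>X x\<bar>)
      + expectation (\<lambda>x. \<bar>X x\<bar> ^ 3) / a"
proof -
  let ?c = "LINT z|std_normal_distribution. h z"
  interpret Q: prob_space Q using coupling by (simp add: is_coupling_def)
  have X1 [measurable]: "X1 \<in> measurable Q N" and X2 [measurable]: "X2 \<in> measurable Q N"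
    and dX1: "distr Q N X1 = distr M N \<tau>" and dX2: "distr Q N X2 = square_biased a K (distr M N \<tau>)"
    using coupling by (auto simp: is_coupling_def)
  obtain f f' where der: "\<And>x. (f has_real_derivative f' x) (at x)"
    and f': "\<And>x. f' x = x * f x + h x - ?c" and f1: "\<And>x. \<bar>f x\<bar> \<le> 1"
    and lip: "\<And>x y. \<bar>f' x - f' y\<bar> \<le> 2 * \<bar>x - y\<bar>"
    using stein_solution[OF h] by blast
  have [measurable]: "h \<in> borel_measurable borel" "f' \<in> borel_measurable borel"
    using Lipschitz_borel_measurable(1)[of h 1] Lipschitz_borel_measurable(1)[of f' 2] h lip by simp_all
  have f [measurable]: "f \<in> borel_measurable borel"
    using der by (intro borel_measurable_continuous_onI) (meson DERIV_continuous_on has_field_derivative_at_within)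
  note mult_f = integrable_mult_bounded[OF _ _ _ f1]
  define c where "c x = (LINT y|K (\<tau> x). (y - \<mu> (\<tau> x)) * f (V (\<tau> x) + y))" for x
  have c: "integrable M c" "expectation c = a * expectation (\<lambda>x. W x * f (W x))"
    unfolding c_def[abs_def]
    by (rule stein_identity[OF f mult_f[OF W_integrable(1) _ f] mult_f[OF W_integrable(2) _ f]]; measurable)+
  define r where "r x = (LINT y|K (\<tau> x). \<bar>y - \<mu> (\<tau> x)\<bar> ^ 3)" for x
  have r: "integrable M r" "expectation r = expectation (\<lambda>x. \<bar>X x\<bar> ^ 3)"
    using T.integrable_kernel_integral[of "\<lambda>(t, y). \<bar>y - \<mu> t\<bar> ^ 3"]
      T.integral_disintegrate[of "\<lambda>(t, y). \<bar>y - \<mu> t\<bar> ^ 3"] X3 by (auto simp: r_def[abs_def])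
  have "AE x in M. integrable (K (\<tau> x)) (\<lambda>y. \<bar>y - \<mu> (\<tau> x)\<bar> ^ 3)"
    using T.AE_integrable_kernel[of "\<lambda>(t, y). \<bar>y - \<mu> t\<bar> ^ 3"] X3 by simp
  \<comment> \<open>Given \<tau>, the constant term of the expansion of \<open>f\<close> at
    \<open>m\<close> drops out because \<open>y - \<mu>\<close> is centred; the linear term
    contributes \<sigma>^2 f'(m), and the quadratic remainder times |y - \<mu>| gives the
    cube.\<close>
  then have taylor: "AE x in M. \<bar>c x - \<sigma>2 (\<tau> x) * f' (m (\<tau> x))\<bar> \<le> r x"
    using AE_kernel_moments AE_space
  proof eventually_elim
    case (elim x)
    let ?k = "K (\<tau> x)" and ?\<mu> = "\<mu> (\<tau> x)" and ?m = "m (\<tau> x)"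
    interpret k: prob_space ?k by (rule T.prob_space_kernel) (use elim in \<open>simp add: T.\<tau>_in_space\<close>)
    have "sets (?k) = sets borel"
      by (rule T.sets_kernel) (use elim in \<open>simp add: T.\<tau>_in_space\<close>)
    then have id: "(\<lambda>y. y) \<in> borel_measurable (?k)" by (rule measurable_ident_sets)
    have i1: "integrable ?k (\<lambda>y. y - ?\<mu>)" using elim by auto
    have i2: "integrable ?k (\<lambda>y. (y - ?\<mu>)\<^sup>2)" using elim by (simp add: power2_diff)
    have iF: "integrable ?k (\<lambda>y. (y - ?\<mu>) * f (V (\<tau> x) + y))" 
      by (rule mult_f[OF i1 _ f]) (intro borel_measurable_add borel_measurable_const id)
    have 0: "(LINT y|?k. y - ?\<mu>) = 0" using elim by (simp add: cond_mean_def k.prob_space)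
    note j1 = integrable_mult_right[OF i1, of "f ?m"] and j2 = integrable_mult_right[OF i2, of "f' ?m"]
    note j = Bochner_Integration.integrable_add[OF j1 j2]
    note ir = Bochner_Integration.integrable_diff[OF iF j]
    have "(LINT y|?k. (y - ?\<mu>) * f (V (\<tau> x) + y) - (f ?m * (y - ?\<mu>) + f' ?m * (y - ?\<mu>)\<^sup>2))
        = c x - (f ?m * (LINT y|?k. y - ?\<mu>) + f' ?m * \<sigma>2 (\<tau> x))"
      unfolding Bochner_Integration.integral_diff[OF iF j] Bochner_Integration.integral_add[OF j1 j2]
      by (simp only: c_def cond_variance_def integral_mult_right_zero)
    then have "\<bar>c x - \<sigma>2 (\<tau> x) * f' ?m\<bar>
        = \<bar>LINT y|?k. (y - ?\<mu>) * f (V (\<tau> x) + y) - (f ?m * (y - ?\<mu>) + f' ?m * (y - ?\<mu>)\<^sup>2)\<bar>"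
      by (simp only: 0) (simp add: mult.commute)
    also have "\<dots> \<le> (LINT y|?k. \<bar>y - ?\<mu>\<bar> ^ 3)"
    proof (rule integral_abs_bound_integral[OF ir elim(1)])
      fix y
      have "(y - ?\<mu>) * f (V (\<tau> x) + y) - (f ?m * (y - ?\<mu>) + f' ?m * (y - ?\<mu>)\<^sup>2)
          = (y - ?\<mu>) * (f (?m + (y - ?\<mu>)) - f ?m - f' ?m * (y - ?\<mu>))"
        by (simp add: algebra_simps power2_eq_square)
      also have "\<bar>\<dots>\<bar> \<le> \<bar>y - ?\<mu>\<bar> * (y - ?\<mu>)\<^sup>2"
        unfolding abs_mult by (intro mult_left_mono second_order_remainder_bound[OF der lip]) simp
      also have "\<dots> = \<bar>y - ?\<mu>\<bar> ^ 3"
        by (simp add: power3_eq_cube power2_eq_square)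
      finally show "\<bar>(y - ?\<mu>) * f (V (\<tau> x) + y) - (f ?m * (y - ?\<mu>) + f' ?m * (y - ?\<mu>)\<^sup>2)\<bar> \<le> \<bar>y - ?\<mu>\<bar> ^ 3" .
    qed
    finally show ?case by (simp add: r_def)
  qed
  \<comment> \<open>\<open>stein_solution\<close> provides no bound on f', so integrability is read
    off from the Taylor comparison.\<close>
  have s: "integrable M (\<lambda>x. \<sigma>2 (\<tau> x) * f' (m (\<tau> x)))"
  proof (rule Bochner_Integration.integrable_bound)
    show "integrable M (\<lambda>x. \<bar>c x\<bar> + r x)" using c r by auto
    show "AE x in M. norm (\<sigma>2 (\<tau> x) * f' (m (\<tau> x))) \<le> norm (\<bar>c x\<bar> + r x)"
      using taylor by eventually_elim auto
  qed measurable
  have step3: "\<bar>a * expectation (\<lambda>x. W x * f (W x)) - expectation (\<lambda>x. \<sigma>2 (\<tau> x) * f' (m (\<tau> x)))\<bar>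
      \<le> expectation (\<lambda>x. \<bar>X x\<bar> ^ 3)"
  proof -
    have "\<bar>expectation (\<lambda>x. c x - \<sigma>2 (\<tau> x) * f' (m (\<tau> x)))\<bar> \<le> expectation (\<lambda>x. \<bar>c x - \<sigma>2 (\<tau> x) * f' (m (\<tau> x))\<bar>)"
      by (rule integral_abs_bound)
    also have "\<dots> \<le> expectation r"
      by (rule integral_mono_AE) (use c r s taylor in auto)
    finally show ?thesis using c r s by simp
  qed
  have hW: "integrable M (\<lambda>x. h (W x))"
  proof (rule Bochner_Integration.integrable_bound)
    show "integrable M (\<lambda>x. \<bar>h 0\<bar> + \<bar>W x\<bar>)" using W_integrable by auto
    show "AE x in M. norm (h (W x)) \<le> norm (\<bar>h 0\<bar> + \<bar>W x\<bar>)"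
    proof (rule AE_I2)
      fix x show "norm (h (W x)) \<le> norm (\<bar>h 0\<bar> + \<bar>W x\<bar>)" using h[of "W x" 0] by auto
    qed
  qed measurable
  have WfW: "integrable M (\<lambda>x. W x * f (W x))" by (rule mult_f[OF W_integrable(1) _ f]) measurable
  have f'W: "integrable M (\<lambda>x. f' (W x))"
    unfolding f' using hW WfW by auto
  have eq: "expectation (\<lambda>x. h (W x)) - ?c = expectation (\<lambda>x. f' (W x)) - expectation (\<lambda>x. W x * f (W x))"
    unfolding f' using hW WfW by (simp add: prob_space)
  have lipX: "\<bar>f' (W x) - f' (m (\<tau> x))\<bar> \<le> 2 * \<bar>X x\<bar>" for x
    using lip[of "W x" "m (\<tau> x)"] by (simp add: W_def)
  have f'm: "integrable M (\<lambda>x. f' (m (\<tau> x)))"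
  proof (rule Bochner_Integration.integrable_bound)
    show "integrable M (\<lambda>x. \<bar>f' (W x)\<bar> + 2 * \<bar>X x\<bar>)" using f'W X_integrable by auto
    show "AE x in M. norm (f' (m (\<tau> x))) \<le> norm (\<bar>f' (W x)\<bar> + 2 * \<bar>X x\<bar>)"
      by (rule AE_I2) (use lipX in \<open>smt (verit) real_norm_def\<close>)
  qed measurable
  have step1: "expectation (\<lambda>x. f' (W x)) - expectation (\<lambda>x. f' (m (\<tau> x))) \<le> 2 * expectation (\<lambda>x. \<bar>X x\<bar>)"
  proof -
    have "expectation (\<lambda>x. f' (W x)) - expectation (\<lambda>x. f' (m (\<tau> x))) = expectation (\<lambda>x. f' (W x) - f' (m (\<tau> x)))"
      by (rule Bochner_Integration.integral_diff[symmetric, OF f'W f'm])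
    also have "\<dots> \<le> expectation (\<lambda>x. 2 * \<bar>X x\<bar>)"
      by (rule integral_mono) (use f'W f'm X_integrable lipX in \<open>auto simp: abs_le_iff\<close>)
    finally show ?thesis by simp
  qed
  \<comment> \<open>This fact and \<open>f'X2\<close> move the expectations to \<open>Q\<close>
    through the marginals alone; the joint law of the coupling enters only in
    \<open>step2\<close>.\<close>
  have f'X1: "integrable Q (\<lambda>q. f' (m (X1 q)))" "expectation (\<lambda>x. f' (m (\<tau> x))) = (LINT q|Q. f' (m (X1 q)))"
  proof -
    have "integrable (distr Q N X1) (\<lambda>t. f' (m t))"
      unfolding dX1 using f'm by (subst integrable_distr_eq) auto
    then show "integrable Q (\<lambda>q. f' (m (X1 q)))" by (subst (asm) integrable_distr_eq) auto
    have "expectation (\<lambda>x. f' (m (\<tau> x))) = (LINT t|distr M N \<tau>. f' (m t))"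
      by (subst integral_distr) auto
    also have "\<dots> = (LINT q|Q. f' (m (X1 q)))"
      unfolding dX1[symmetric] by (subst integral_distr) auto
    finally show "expectation (\<lambda>x. f' (m (\<tau> x))) = (LINT q|Q. f' (m (X1 q)))" .
  qed
  have f'X2: "integrable Q (\<lambda>q. f' (m (X2 q)))"
    "expectation (\<lambda>x. \<sigma>2 (\<tau> x) * f' (m (\<tau> x))) = a * (LINT q|Q. f' (m (X2 q)))"
  proof -
    have "integrable (distr Q N X2) (\<lambda>t. f' (m t))"
      unfolding dX2 using s by (subst integrable_square_biased) auto
    then show "integrable Q (\<lambda>q. f' (m (X2 q)))" by (subst (asm) integrable_distr_eq) auto
    have "(LINT q|Q. f' (m (X2 q))) = integral\<^sup>L (distr Q N X2) (\<lambda>t. f' (m t))"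
      by (subst integral_distr) auto
    also have "\<dots> = expectation (\<lambda>x. \<sigma>2 (\<tau> x) * f' (m (\<tau> x))) / a"
      unfolding dX2 by (subst integral_square_biased) auto
    finally show "expectation (\<lambda>x. \<sigma>2 (\<tau> x) * f' (m (\<tau> x))) = a * (LINT q|Q. f' (m (X2 q)))"
      using a_pos by simp
  qed
  have step2: "(LINT q|Q. f' (m (X1 q))) - (LINT q|Q. f' (m (X2 q))) \<le> 2 * (LINT q|Q. \<bar>m (X2 q) - m (X1 q)\<bar>)"
  proof -
    have "(LINT q|Q. f' (m (X1 q))) - (LINT q|Q. f' (m (X2 q))) = (LINT q|Q. f' (m (X1 q)) - f' (m (X2 q)))"
      by (rule Bochner_Integration.integral_diff[symmetric, OF f'X1(1) f'X2(1)])
    also have "\<dots> \<le> (LINT q|Q. 2 * \<bar>m (X2 q) - m (X1 q)\<bar>)"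
    proof (rule integral_mono)
      show "f' (m (X1 q)) - f' (m (X2 q)) \<le> 2 * \<bar>m (X2 q) - m (X1 q)\<bar>" for q
        using lip[of "m (X1 q)" "m (X2 q)"] by (simp add: abs_minus_commute abs_le_iff)
    qed (use f'X1 f'X2 Q in auto)
    finally show ?thesis by simp
  qed
  have "(LINT q|Q. f' (m (X2 q))) - expectation (\<lambda>x. W x * f (W x)) \<le> expectation (\<lambda>x. \<bar>X x\<bar> ^ 3) / a"
  proof -
    have "a * ((LINT q|Q. f' (m (X2 q))) - expectation (\<lambda>x. W x * f (W x))) \<le> expectation (\<lambda>x. \<bar>X x\<bar> ^ 3)"
      using step3 unfolding f'X2(2) by (simp add: right_diff_distrib)
    then show ?thesis using a_pos by (simp add: pos_le_divide_eq mult.commute)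
  qed
  with step1 step2 show ?thesis unfolding eq f'X1(2) by linarith
qed

text \<open>The estimate for every Lipschitz test function is passed through duality, and the real
  integrals are then rewritten as extended ones.\<close>

lemma L1_dist_bound:
  assumes coupling: "is_coupling Q N X1 (distr M N \<tau>) X2 (square_biased a K (distr M N \<tau>))"
  shows "L1_dist (distr M borel W) std_normal_distribution
    \<le> 2 * (\<integral>\<^sup>+ q. ennreal \<bar>(V (X2 q) - V (X1 q)) + (\<mu> (X2 q) - \<mu> (X1 q))\<bar> \<partial>Q)
      + 2 * (\<integral>\<^sup>+ x. ennreal \<bar>X x\<bar> \<partial>M)
      + (\<integral>\<^sup>+ x. ennreal (\<bar>X x\<bar> ^ 3) \<partial>M) / ennreal (variance X)"
  (is "_ \<le> 2 * ?A + 2 * ?B + ?C / _")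
\<comment> \<open>\<open>?B\<close> is finite by \<open>X_integrable\<close>. If \<open>?A\<close>
  or \<open>?C\<close> is infinite, so is the right side, because the denominator is the finite
  number \<open>a\<close>.\<close>
proof (cases "?A = \<infinity> \<or> ?C = \<infinity>")
  case True
  then show ?thesis
    using a_pos by (auto simp: variance_X ennreal_mult_top ennreal_top_divide)
next
  case False
  have [measurable]: "X1 \<in> measurable Q N" "X2 \<in> measurable Q N"
    using coupling by (auto simp: is_coupling_def)
  have m_eq: "(V (X2 q) - V (X1 q)) + (\<mu> (X2 q) - \<mu> (X1 q)) = m (X2 q) - m (X1 q)" for q by simp
  have Q: "integrable Q (\<lambda>q. \<bar>m (X2 q) - m (X1 q)\<bar>)"
    using False unfolding m_eq by (intro integrableI_nonneg) (auto simp: less_top)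
  have X3: "integrable M (\<lambda>x. \<bar>X x\<bar> ^ 3)"
    using False by (intro integrableI_nonneg) (auto simp: less_top)
  let ?R = "2 * (LINT q|Q. \<bar>m (X2 q) - m (X1 q)\<bar>) + 2 * expectation (\<lambda>x. \<bar>X x\<bar>)
      + expectation (\<lambda>x. \<bar>X x\<bar> ^ 3) / a"
  have "L1_dist (distr M borel W) std_normal_distribution \<le> ennreal ?R"
  proof (rule L1_dist_le_Lipschitz)
    show "real_distribution (distr M borel W)" by (rule real_distribution_distr) measurable
    show "integrable (distr M borel W) (\<lambda>x. x)" using W_integrable by (subst integrable_distr_eq) auto
    show "real_distribution std_normal_distribution" by (rule real_dist_normal_dist)
    show "integrable std_normal_distribution (\<lambda>x. x)" by (rule integrable_std_normal_distribution_id)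
    fix h :: "real \<Rightarrow> real" assume h: "\<And>x y. \<bar>h x - h y\<bar> \<le> \<bar>x - y\<bar>"
    have "h \<in> borel_measurable borel" using Lipschitz_borel_measurable(1)[of h 1] h by simp
    then have "integral\<^sup>L (distr M borel W) h = expectation (\<lambda>x. h (W x))"
      by (subst integral_distr) auto
    then show "integral\<^sup>L (distr M borel W) h - integral\<^sup>L std_normal_distribution h \<le> ?R"
      using Lipschitz_expectation_bound[OF h X3 coupling Q] by simp
  qed
  also have "ennreal ?R = 2 * ?A + 2 * ?B + ?C / ennreal (variance X)"
  proof -
    have "?A = ennreal (LINT q|Q. \<bar>m (X2 q) - m (X1 q)\<bar>)"
      unfolding m_eq by (rule nn_integral_eq_integral[OF Q]) simp
    moreover have "?B = ennreal (expectation (\<lambda>x. \<bar>X x\<bar>))"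
      by (rule nn_integral_eq_integral) (use X_integrable in auto)
    moreover have "?C = ennreal (expectation (\<lambda>x. \<bar>X x\<bar> ^ 3))"
      by (rule nn_integral_eq_integral[OF X3]) simp
    ultimately show ?thesis
      using a_pos by (simp add: variance_X ennreal_plus ennreal_mult divide_ennreal del: power_abs)
  qed
  finally show ?thesis .
qed

text \<open>A constant conditional variance must equal its expectation \<open>a\<close>, so the
  density is 1 almost everywhere and the square-biased law is the law of \<tau>. Coupling \<tau>
  with itself makes the first term vanish, and \<open>X\<close> agrees with \<open>T\<close> almost
  surely.\<close>

lemma L1_dist_bound_centered:
  assumes mean: "AE x in M. \<mu> (\<tau> x) = 0" and var: "AE x in M. \<sigma>2 (\<tau> x) = c"
  shows "L1_dist (distr M borel W) std_normal_distribution
    \<le> 2 * (\<integral>\<^sup>+ x. ennreal \<bar>T x\<bar> \<partial>M) + (\<integral>\<^sup>+ x. ennreal (\<bar>T x\<bar> ^ 3) \<partial>M) / ennreal (variance T)"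
proof -
  have "expectation (\<lambda>x. \<sigma>2 (\<tau> x)) = expectation (\<lambda>_. c)"
    by (rule integral_cong_AE) (use var in auto)
  then have c: "c = a" by (simp add: expectation_cond_variance prob_space)
  have "square_biased a K (distr M N \<tau>) = density (distr M N \<tau>) (\<lambda>_. 1)"
    unfolding square_biased_def
  proof (rule density_cong)
    have "AE x in M. ennreal (\<sigma>2 (\<tau> x) / a) = 1"
      using var by eventually_elim (use a_pos c in simp)
    then show "AE t in distr M N \<tau>. ennreal (\<sigma>2 t / a) = 1"
      by (subst AE_distr_iff) auto
  qed auto
  then have "is_coupling M N \<tau> (distr M N \<tau>) \<tau> (square_biased a K (distr M N \<tau>))"
    by (simp add: is_coupling_def density_1 prob_space_axioms)
  note L1_dist_bound[OF this]
  moreover have XT: "AE x in M. X x = T x" using mean by eventually_elim simp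
  moreover have "(\<integral>\<^sup>+ x. ennreal \<bar>X x\<bar> \<partial>M) = (\<integral>\<^sup>+ x. ennreal \<bar>T x\<bar> \<partial>M)"
    by (rule nn_integral_cong_AE) (use XT in eventually_elim, simp)
  moreover have "(\<integral>\<^sup>+ x. ennreal (\<bar>X x\<bar> ^ 3) \<partial>M) = (\<integral>\<^sup>+ x. ennreal (\<bar>T x\<bar> ^ 3) \<partial>M)"
    by (rule nn_integral_cong_AE) (use XT in eventually_elim, simp)
  moreover have "variance X = variance T"
  proof -
    have e: "expectation X = expectation T" by (rule integral_cong_AE) (use XT in auto)
    show ?thesis
      unfolding e
      by (rule integral_cong_AE) (use XT in \<open>auto elim: eventually_mono\<close>)
  qed
  ultimately show ?thesis by simp
qed

end

text \<open>Extended nonnegative integrals on the right let the bound hold, possibly trivially, when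
  the third moment or the coupling distance is infinite.\<close>

theorem theorem3p1:
  fixes M :: "'a measure" and N :: "'b measure" and \<tau> :: "'a \<Rightarrow> 'b"
    and T T' :: "'a \<Rightarrow> real" and V :: "'b \<Rightarrow> real" and K :: "'b \<Rightarrow> real measure" and a :: real
  defines "W \<equiv> \<lambda>x. V (\<tau> x) + T x"
    and "W' \<equiv> \<lambda>x. V (\<tau> x) + T' x"
    and "\<mu> \<equiv> cond_mean K"
    and "F \<equiv> distr M N \<tau>"
    and "F_box \<equiv> square_biased a K (distr M N \<tau>)"
  assumes "prob_space M"
    and "V \<in> borel_measurable N"
    and "regular_cond_distr M N \<tau> borel T K"
    and "regular_cond_distr M N \<tau> (borel \<Otimes>\<^sub>M borel) (\<lambda>x. (T x, T' x)) (\<lambda>t. K t \<Otimes>\<^sub>M K t)"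
    and "integrable M (\<lambda>x. (W x)\<^sup>2)" and "prob_space.variance M W = 1"
    and "integrable M (\<lambda>x. (W' x)\<^sup>2)" and "prob_space.variance M W' = 1"
    and "stein_pair M a W W'"
  shows "prob_space F_box \<and>
    (\<forall>(Q :: 'q measure) X Y. is_coupling Q N X F Y F_box \<longrightarrow>
       L1_dist (distr M borel W) std_normal_distribution
         \<le> 2 * (\<integral>\<^sup>+ q. ennreal \<bar>(V (Y q) - V (X q)) + (\<mu> (Y q) - \<mu> (X q))\<bar> \<partial>Q)
           + 2 * (\<integral>\<^sup>+ x. ennreal \<bar>T x - \<mu> (\<tau> x)\<bar> \<partial>M)
           + (\<integral>\<^sup>+ x. ennreal (\<bar>T x - \<mu> (\<tau> x)\<bar> ^ 3) \<partial>M)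
             / ennreal (prob_space.variance M (\<lambda>x. T x - \<mu> (\<tau> x)))) \<and>
    ((AE x in M. \<mu> (\<tau> x) = 0) \<and> (\<exists>c. AE x in M. cond_variance K (\<tau> x) = c) \<longrightarrow>
       L1_dist (distr M borel W) std_normal_distribution
         \<le> 2 * (\<integral>\<^sup>+ x. ennreal \<bar>T x\<bar> \<partial>M)
           + (\<integral>\<^sup>+ x. ennreal (\<bar>T x\<bar> ^ 3) \<partial>M) / ennreal (prob_space.variance M T))"
proof -
  interpret prob_space M by fact
  interpret conditional_stein_pair M N \<tau> T T' V K a W W'
    unfolding W_def W'_def
    by unfold_locales (use assms in \<open>simp_all add: W_def W'_def\<close>)
  show ?thesis
    unfolding F_def F_box_def \<mu>_def
    using prob_space_square_biased L1_dist_bound L1_dist_bound_centered by blast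
qed

end
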